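(* Let $X$ be an unbounded metric space with corona $\check X$. Then the minimal character of $\check X$ is $$\mathrm{m}\chi(\check X)=\begin{cases}\mathfrak u&\text{if $X$ has asymptotically isolated balls},\\ \max\{\mathfrak u,\mathfrak d\}&\text{otherwise}.\end{cases}$$
   Context: For a metric space $(X,d)$, $B_\varepsilon(x)=\{y\in X:d(x,y)\le\varepsilon\}$ and, for $A\subset X$, $B_\varepsilon(A)=\bigcup_{a\in A}B_\varepsilon(a)$. Corona: let $X$ be an unbounded metric space. Let $\beta X_d$ be the Stone-Čech compactification of $X$ endowed with the discrete topology, i.e. the space of all ultrafilters on the set $X$ with the topology generated by the sets $\bar A=\{p:A\in p\}$, $A\subset X$. Let $X^\sharp\subset\beta X_d$ be the closed subspace of all ultrafilters containing every set $X\setminus B$ with $B\subset X$ bounded. Two ultrafilters $p,q\in X^\sharp$ are parallel if for some real $\varepsilon>0$ we have $\{B_\varepsilon(P):P\in p\}\subset q$ and $\{B_\varepsilon(Q):Q\in q\}\subset p$. The corona $\check X$ is the quotient space $X^\sharp/_\sim$, where $\sim$ is the smallest closed equivalence relation on $X^\sharp$ (closed as a subset of $X^\sharp\times X^\sharp$) containing the parallel relation. Asymptotically isolated balls: $X$ has asymptotically isolated balls if there is $\varepsilon<\infty$ such that for every finite $\delta\ge\varepsilon$ there is $x\in X$ with $B_\varepsilon(x)=B_\delta(x)$. Characters: for a topological space $T$ and $t\in T$, the character $\chi(t,T)$ is the smallest cardinality of a neighborhood base at $t$; the minimal character is $\mathrm{m}\chi(T)=\min_{t\in T}\chi(t,T)$.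 Cardinals: $\mathfrak u=\mathrm{m}\chi(\omega^* )$, where $\omega^*=\beta\omega\setminus\omega$ is the Stone-Čech remainder of the countable discrete space $\omega$; $\mathfrak d$ is the cofinality of the set $\omega^\omega$ of all functions $\omega\to\omega$ ordered by $f\le g$ iff $f(n)\le g(n)$ for all $n$. *)

theory Defs
  imports "HOL-Analysis.Analysis"
begin

no_notation elt_set_eq (infix \<open>=o\<close> 50)
unbundle cardinal_syntax

text \<open>Cardinals are cardinal orders up to \<open>=o\<close>, so the least element of a set of cardinals
  is a choice, determined only up to this relation.\<close>

definition cleast :: "'a rel set \<Rightarrow> 'a rel" where
  "cleast R = (SOME r. r \<in> R \<and> (\<forall>s\<in>R. r \<le>o s))"

lemma cleast:
  assumes "R \<noteq> {}" and "\<And>r. r \<in> R \<Longrightarrow> Card_order r"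
  shows "cleast R \<in> R" and "s \<in> R \<Longrightarrow> cleast R \<le>o s"
proof -
  have "\<exists>r. r \<in> R \<and> (\<forall>s\<in>R. r \<le>o s)"
    using exists_minim_Card_order[of R] assms by blast
  then have *: "cleast R \<in> R \<and> (\<forall>s\<in>R. cleast R \<le>o s)"
    unfolding cleast_def by (rule someI_ex)
  then show "cleast R \<in> R" by blast
  show "s \<in> R \<Longrightarrow> cleast R \<le>o s" using * by blast
qed

text \<open>The larger of two cardinals living on different types, copied to the sum type.\<close>

definition cmax :: "'a rel \<Rightarrow> 'b rel \<Rightarrow> ('a + 'b) rel" where
  "cmax r s = (if r \<le>o s then |Inr ` Field s| else |Inl ` Field r| )"

lemma cmax_eq_right:
  assumes "Card_order s" and "r \<le>o s"
  shows "cmax r s =o s"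
proof -
  have "|Inr ` Field s| =o |Field s|"
    using card_of_ordIsoI[OF inj_on_imp_bij_betw[of Inr "Field s"]] ordIso_symmetric by simp
  also have "|Field s| =o s"
    using assms(1) by (rule card_of_Field_ordIso)
  finally show ?thesis
    unfolding cmax_def using assms(2) by simp
qed

lemma cmax_eq_left:
  assumes "Card_order r" and "\<not> r \<le>o s"
  shows "cmax r s =o r"
proof -
  have "|Inl ` Field r| =o |Field r|"
    using card_of_ordIsoI[OF inj_on_imp_bij_betw[of Inl "Field r"]] ordIso_symmetric by simp
  also have "|Field r| =o r"
    using assms(1) by (rule card_of_Field_ordIso)
  finally show ?thesis
    unfolding cmax_def using assms(2) by simp
qed

text \<open>Neighborhoods are not required to be open.\<close>

definition nbhd_base :: "'a topology \<Rightarrow> 'a \<Rightarrow> 'a set set \<Rightarrow> bool" where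
  "nbhd_base T t \<B> \<longleftrightarrow>
     (\<forall>N\<in>\<B>. N \<subseteq> topspace T \<and> (\<exists>U. openin T U \<and> t \<in> U \<and> U \<subseteq> N)) \<and>
     (\<forall>U. openin T U \<and> t \<in> U \<longrightarrow> (\<exists>N\<in>\<B>. N \<subseteq> U))"

definition character :: "'a topology \<Rightarrow> 'a \<Rightarrow> 'a set rel" where
  "character T t = cleast {|\<B>| |\<B>. nbhd_base T t \<B>}"

definition min_character :: "'a topology \<Rightarrow> 'a set rel" where
  "min_character T = cleast (character T ` topspace T)"

lemma nbhd_base_open_sets: "nbhd_base T t {U. openin T U \<and> t \<in> U}"
  unfolding nbhd_base_def using openin_subset by blast

lemma character_witness:
  obtains \<B> where "nbhd_base T t \<B>" and "character T t = |\<B>|"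
proof -
  have "character T t \<in> {|\<B>| |\<B>. nbhd_base T t \<B>}"
    unfolding character_def
  proof (rule cleast(1))
    show "{|\<B>| |\<B>. nbhd_base T t \<B>} \<noteq> {}"
      using nbhd_base_open_sets[of T t] by blast
  qed (auto simp: card_of_Card_order)
  then show thesis using that by blast
qed

text \<open>A subset \<open>A\<close> belongs to the ultrafilter \<open>p\<close> iff \<open>\<forall>\<^sub>F x in p. x \<in> A\<close>.\<close>

definition ultrafilter :: "'a filter \<Rightarrow> bool" where
  "ultrafilter p \<longleftrightarrow> p \<noteq> bot \<and> (\<forall>A. (\<forall>\<^sub>F x in p. x \<in> A) \<or> (\<forall>\<^sub>F x in p. x \<in> - A))"

definition stone_cech :: "'a filter topology" where
  "stone_cech = topology_generated_by (range (\<lambda>A. {p. ultrafilter p \<and> (\<forall>\<^sub>F x in p. x \<in> A)}))"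

lemma topspace_stone_cech: "topspace stone_cech = {p :: 'a filter. ultrafilter p}"
proof -
  have "\<forall>\<^sub>F x in p. x \<in> UNIV" for p :: "'a filter" by simp
  then show ?thesis unfolding stone_cech_def topology_generated_by_topspace by blast
qed

text \<open>The points of a discrete space are identified with the principal ultrafilters.\<close>

definition stone_cech_remainder :: "'a filter topology" where
  "stone_cech_remainder = subtopology stone_cech (- range (\<lambda>x. principal {x}))"

definition cardinal_u :: "nat filter set rel" where
  "cardinal_u = min_character (stone_cech_remainder :: nat filter topology)"

definition cardinal_d :: "(nat \<Rightarrow> nat) rel" where
  "cardinal_d = cleast {|D| |D. \<forall>f. \<exists>g\<in>D. f \<le> g}"

definition quotient_topology :: "'a topology \<Rightarrow> ('a \<times> 'a) set \<Rightarrow> 'a set topology" where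
  "quotient_topology T R =
     topology (\<lambda>\<U>. \<U> \<subseteq> topspace T // R \<and> openin T {t \<in> topspace T. R `` {t} \<in> \<U>})"

lemma openin_quotient_topology:
  "openin (quotient_topology T R) \<U> \<longleftrightarrow>
     \<U> \<subseteq> topspace T // R \<and> openin T {t \<in> topspace T. R `` {t} \<in> \<U>}"
proof -
  have "istopology (\<lambda>\<U>. \<U> \<subseteq> topspace T // R \<and> openin T {t \<in> topspace T. R `` {t} \<in> \<U>})"
    unfolding istopology_def
  proof (intro conjI allI impI)
    fix \<U> \<V>
    assume "\<U> \<subseteq> topspace T // R \<and> openin T {t \<in> topspace T. R `` {t} \<in> \<U>}"
      and "\<V> \<subseteq> topspace T // R \<and> openin T {t \<in> topspace T. R `` {t} \<in> \<V>}"
    moreover have "{t \<in> topspace T. R `` {t} \<in> \<U> \<inter> \<V>} =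
        {t \<in> topspace T. R `` {t} \<in> \<U>} \<inter> {t \<in> topspace T. R `` {t} \<in> \<V>}" by blast
    ultimately show "openin T {t \<in> topspace T. R `` {t} \<in> \<U> \<inter> \<V>}"
      by (simp add: openin_Int)
  next
    fix \<K>
    assume "\<forall>\<U>\<in>\<K>. \<U> \<subseteq> topspace T // R \<and> openin T {t \<in> topspace T. R `` {t} \<in> \<U>}"
    moreover have "{t \<in> topspace T. R `` {t} \<in> \<Union>\<K>} =
        (\<Union>\<U>\<in>\<K>. {t \<in> topspace T. R `` {t} \<in> \<U>})" by blast
    ultimately show "openin T {t \<in> topspace T. R `` {t} \<in> \<Union>\<K>}"
      by (simp, intro openin_Union) blast
  qed blast+
  then show ?thesis
    unfolding quotient_topology_def by (simp add: topology_inverse')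
qed

lemma topspace_quotient_topology: "topspace (quotient_topology T R) = topspace T // R"
proof -
  have "{t \<in> topspace T. R `` {t} \<in> topspace T // R} = topspace T"
    by (auto intro: quotientI)
  then have "openin (quotient_topology T R) (topspace T // R)"
    by (simp add: openin_quotient_topology)
  moreover have "topspace (quotient_topology T R) \<subseteq> topspace T // R"
    using openin_topspace[of "quotient_topology T R"]
    unfolding openin_quotient_topology by (rule conjunct1)
  ultimately show ?thesis
    by (intro subset_antisym openin_subset)
qed

definition sharp :: "'a::metric_space filter topology" where
  "sharp = subtopology stone_cech {p. \<forall>B. bounded B \<longrightarrow> (\<forall>\<^sub>F x in p. x \<in> - B)}"

definition set_nbhd :: "real \<Rightarrow> 'a::metric_space set \<Rightarrow> 'a set" where
  "set_nbhd \<epsilon> A = (\<Union>a\<in>A. cball a \<epsilon>)"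

definition parallel :: "('a::metric_space filter \<times> 'a filter) set" where
  "parallel = {(p, q). p \<in> topspace sharp \<and> q \<in> topspace sharp \<and>
     (\<exists>\<epsilon>>0. (\<forall>P. (\<forall>\<^sub>F x in p. x \<in> P) \<longrightarrow> (\<forall>\<^sub>F x in q. x \<in> set_nbhd \<epsilon> P)) \<and>
            (\<forall>Q. (\<forall>\<^sub>F x in q. x \<in> Q) \<longrightarrow> (\<forall>\<^sub>F x in p. x \<in> set_nbhd \<epsilon> Q)))}"

definition corona_rel :: "('a::metric_space filter \<times> 'a filter) set" where
  "corona_rel = \<Inter>{E. equiv (topspace sharp) E \<and> closedin (prod_topology sharp sharp) E \<and>
                   parallel \<subseteq> E}"

lemma corona_rel:
  "equiv (topspace sharp) (corona_rel :: ('a::metric_space filter \<times> 'a filter) set)"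
  "closedin (prod_topology sharp sharp) (corona_rel :: ('a filter \<times> 'a filter) set)"
  "parallel \<subseteq> (corona_rel :: ('a filter \<times> 'a filter) set)"
proof -
  let ?S = "topspace (sharp :: 'a filter topology)"
  let ?\<E> = "{E. equiv ?S E \<and> closedin (prod_topology sharp sharp) E \<and> parallel \<subseteq> E}"
  have "closedin (prod_topology sharp sharp) (?S \<times> ?S)"
    by (metis closedin_topspace topspace_prod_topology)
  then have top: "?S \<times> ?S \<in> ?\<E>"
    by (auto simp: parallel_def equiv_def refl_on_def sym_def trans_def)
  have sub: "corona_rel \<subseteq> ?S \<times> ?S"
    unfolding corona_rel_def using top by (rule Inter_lower)
  show "equiv ?S corona_rel"
  proof (rule equivI[OF sub])
    show "refl_on ?S corona_rel"
      unfolding corona_rel_def equiv_def refl_on_def by blast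
    show "sym (corona_rel :: ('a filter \<times> 'a filter) set)"
      unfolding corona_rel_def equiv_def sym_def by blast
    show "trans (corona_rel :: ('a filter \<times> 'a filter) set)"
    proof (rule transI)
      fix p q r :: "'a filter"
      assume "(p, q) \<in> corona_rel" and "(q, r) \<in> corona_rel"
      then have "(p, r) \<in> E" if "E \<in> ?\<E>" for E
        using that transD[of E p q r] unfolding corona_rel_def equiv_def by blast
      then show "(p, r) \<in> corona_rel"
        unfolding corona_rel_def by blast
    qed
  qed
  show "closedin (prod_topology sharp sharp) (corona_rel :: ('a filter \<times> 'a filter) set)"
    unfolding corona_rel_def by (rule closedin_Inter) (use top in blast)+
  show "parallel \<subseteq> (corona_rel :: ('a filter \<times> 'a filter) set)"
    unfolding corona_rel_def by blast
qed

definition corona :: "'a::metric_space filter set topology" where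
  "corona = quotient_topology sharp corona_rel"

text \<open>No lower bound on \<open>\<epsilon>\<close> is needed: a negative \<open>\<epsilon>\<close> fails for \<open>\<delta> = 0\<close>.\<close>

definition asymptotically_isolated_balls :: "'a::metric_space itself \<Rightarrow> bool" where
  "asymptotically_isolated_balls _ \<longleftrightarrow>
     (\<exists>\<epsilon>::real. \<forall>\<delta>\<ge>\<epsilon>. \<exists>x::'a. cball x \<epsilon> = cball x \<delta>)"

end

theory Submission
  imports Defs
begin

text \<open>
  Call two sets asymptotically disjoint if their \<open>\<epsilon>\<close>-neighborhoods have bounded intersection for every
  \<open>\<epsilon>\<close>. By normality, the closure of the parallel relation is already an equivalence relation, so
  \<open>p\<close> and \<open>q\<close> have the same image in the corona iff they contain no asymptotically disjoint members.
  Hence the neighborhoods of the class of \<open>p\<close> correspond to the filter \<open>F\<close> of asymptotic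
  neighborhoods of members of \<open>p\<close>, and the character of the corona there is the least size of a base
  of \<open>F\<close> modulo bounded sets.

  Rounding a slowly oscillating function maps \<open>F\<close> onto a free ultrafilter on \<open>\<omega>\<close>, so every character
  is at least \<open>\<uu>\<close>. Conversely, an ultrafilter of character \<open>\<uu>\<close> carried by a sequence
  tending to infinity has character at most \<open>max(\<uu>, \<dd>)\<close>, since its asymptotic neighborhoods are
  determined by a member and a growth rate of the radii; along asymptotically isolated balls the growth
  rate is irrelevant.

  Without asymptotically isolated balls, for every \<open>f\<close> there are asymptotically disjoint sets both
  meeting every ball whose radius is of scale \<open>k\<close> and whose center has norm below \<open>f k\<close>. The filter \<open>F\<close>
  contains the complement of one of them, and a member of \<open>F\<close> avoiding that set contains no such ball.
  So the functions telling how far away a base set first contains a ball of scale \<open>k\<close> form a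
  family dominating modulo finite sets.
\<close>

section \<open>Ultrafilters and characters\<close>

abbreviation contains :: "'a filter \<Rightarrow> 'a set \<Rightarrow> bool" where
  "contains p A \<equiv> \<forall>\<^sub>F x in p. x \<in> A"

lemma contains_mono: "contains p A \<Longrightarrow> A \<subseteq> B \<Longrightarrow> contains p B"
  by (auto elim: eventually_mono)

lemma contains_Int: "contains p (A \<inter> B) \<longleftrightarrow> contains p A \<and> contains p B"
  by (simp add: eventually_conj_iff)

lemma ultrafilter_Compl:
  assumes "ultrafilter p"
  shows "contains p (- A) \<longleftrightarrow> \<not> contains p A"
proof
  assume *: "contains p (- A)"
  show "\<not> contains p A"
  proof
    assume "contains p A"
    with * have "\<forall>\<^sub>F x in p. False" by eventually_elim simp
    then show False using assms by (simp add: ultrafilter_def trivial_limit_def)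
  qed
qed (use assms in \<open>auto simp: ultrafilter_def\<close>)

lemma ultrafilter_nonempty: "ultrafilter p \<Longrightarrow> contains p A \<Longrightarrow> A \<noteq> {}"
  using ultrafilter_Compl[of p A] by auto

lemma ultrafilter_Un:
  assumes "ultrafilter p" "contains p (A \<union> B)"
  shows "contains p A \<or> contains p B"
proof (rule disjCI)
  assume "\<not> contains p B"
  then have "contains p (- B)" using ultrafilter_Compl[OF assms(1)] by blast
  with assms(2) show "contains p A" by eventually_elim auto
qed

lemma ultrafilter_filtermap:
  assumes "ultrafilter p"
  shows "ultrafilter (filtermap f p)"
proof -
  have "contains p (f -` A) \<or> contains p (- (f -` A))" for A
    using assms unfolding ultrafilter_def by blast
  then show ?thesis
    using assms by (simp add: ultrafilter_def filtermap_bot_iff eventually_filtermap)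
qed

text \<open>Zorn's lemma for the proper filters below \<open>F\<close> in reverse order. The infimum
  of a nonempty chain stays proper, since eventuality for it is already witnessed by one member of
  the chain.\<close>

lemma le_ultrafilter:
  assumes "F \<noteq> bot"
  obtains p where "ultrafilter p" "p \<le> F"
proof -
  let ?A = "{G. G \<noteq> bot \<and> G \<le> F}"
  have "\<exists>m\<in>?A. \<forall>a\<in>?A. a \<le> m \<longrightarrow> a = m"
  proof (rule predicate_Zorn[where P = "\<lambda>x y. y \<le> x"])
    show "partial_order_on ?A (relation_of (\<lambda>x y. y \<le> x) ?A)"
      by (auto simp: partial_order_on_def preorder_on_def relation_of_def refl_on_def
          trans_def antisym_def)
    fix C assume C: "C \<in> Chains (relation_of (\<lambda>x y. y \<le> x) ?A)"
    then have sub: "C \<subseteq> ?A" and tot: "\<And>x y. x \<in> C \<Longrightarrow> y \<in> C \<Longrightarrow> x \<le> y \<or> y \<le> x"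
      by (auto simp: Chains_def relation_of_def)
    show "\<exists>u\<in>?A. \<forall>a\<in>C. u \<le> a"
    proof (cases "C = {}")
      case False
      have "eventually P (Inf C) \<longleftrightarrow> (\<exists>b\<in>C. eventually P b)" for P
        using False by (rule eventually_Inf_base) (use tot in force)
      then have "Inf C \<noteq> bot"
        using sub by (fastforce simp: trivial_limit_def)
      moreover have "Inf C \<le> F"
        using False sub by (auto intro: Inf_lower2)
      ultimately show ?thesis by (auto intro: Inf_lower)
    qed (use assms in auto)
  qed
  then obtain m where m: "m \<noteq> bot" "m \<le> F" "\<And>a. a \<noteq> bot \<Longrightarrow> a \<le> F \<Longrightarrow> a \<le> m \<Longrightarrow> a = m"
    by auto
  \<comment> \<open>By minimality, restricting \<open>m\<close> to \<open>A\<close> gives either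
    \<open>bot\<close> or \<open>m\<close> again.\<close>
  have "contains m A \<or> contains m (- A)" for A
  proof (cases "inf m (principal A) = bot")
    case True
    then show ?thesis
      unfolding trivial_limit_def eventually_inf_principal by simp
  next
    case False
    then have "inf m (principal A) = m"
      by (intro m(3)) (use m(2) in \<open>auto intro: le_infI1\<close>)
    moreover have "contains (inf m (principal A)) A"
      by (simp add: eventually_inf_principal)
    ultimately show ?thesis by simp
  qed
  with m that show thesis by (auto simp: ultrafilter_def)
qed

lemma le_ultrafilter_contains:
  assumes "\<not> contains F (- A)"
  obtains p where "ultrafilter p" "p \<le> F" "contains p A"
proof -
  have "inf F (principal A) \<noteq> bot"
    using assms by (simp add: trivial_limit_def eventually_inf_principal)
  then obtain p where "ultrafilter p" "p \<le> inf F (principal A)"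
    by (rule le_ultrafilter)
  then show thesis
    using that[of p] by (auto simp: le_principal)
qed

section \<open>The topology of the Stone-Cech compactification and its subspaces\<close>

text \<open>The generating sets are closed under finite intersections, so the subbase is a
  base.\<close>

lemma openin_stone_cech:
  "openin stone_cech U \<longleftrightarrow>
     U \<subseteq> Collect ultrafilter \<and>
     (\<forall>p\<in>U. \<exists>A. contains p A \<and> (\<forall>q. ultrafilter q \<longrightarrow> contains q A \<longrightarrow> q \<in> U))"
    (is "_ \<longleftrightarrow> ?R U")
proof
  assume "openin stone_cech U"
  then have "generate_topology_on (range (\<lambda>A. {p. ultrafilter p \<and> contains p A})) U"
    unfolding stone_cech_def openin_topology_generated_by_iff .
  then show "?R U"
  proof induction
    case (Int a b)
    show ?case
    proof (intro conjI ballI)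
      fix p assume "p \<in> a \<inter> b"
      then obtain A B where "contains p A" "\<forall>q. ultrafilter q \<longrightarrow> contains q A \<longrightarrow> q \<in> a"
        "contains p B" "\<forall>q. ultrafilter q \<longrightarrow> contains q B \<longrightarrow> q \<in> b"
        using Int by blast
      then show "\<exists>A. contains p A \<and> (\<forall>q. ultrafilter q \<longrightarrow> contains q A \<longrightarrow> q \<in> a \<inter> b)"
        by (intro exI[of _ "A \<inter> B"]) (auto simp: contains_Int simp del: Int_iff)
    qed (use Int in blast)
  next
    case (UN K)
    then show ?case by (meson Union_iff Sup_least)
  qed auto
next
  assume R: "?R U"
  let ?\<K> = "{{q. ultrafilter q \<and> contains q A} |A. {q. ultrafilter q \<and> contains q A} \<subseteq> U}"
  have "U = \<Union>?\<K>"
    using R by blast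
  moreover have "openin stone_cech (\<Union>?\<K>)"
    unfolding stone_cech_def
    by (rule openin_Union, rule topology_generated_by_Basis) blast
  ultimately show "openin stone_cech U" by simp
qed

lemma topspace_subtopology_stone_cech:
  "topspace (subtopology stone_cech S) = {p \<in> S. ultrafilter p}"
  by (auto simp: topspace_stone_cech)

lemma openin_subtopology_stone_cech:
  "openin (subtopology stone_cech S) U \<longleftrightarrow>
     U \<subseteq> topspace (subtopology stone_cech S) \<and>
     (\<forall>p\<in>U. \<exists>A. contains p A \<and>
        (\<forall>q\<in>topspace (subtopology stone_cech S). contains q A \<longrightarrow> q \<in> U))"
    (is "_ \<longleftrightarrow> ?R")
proof
  assume "openin (subtopology stone_cech S) U"
  then obtain V where "openin stone_cech V" "U = V \<inter> S"
    unfolding openin_subtopology by blast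
  then show ?R
    unfolding openin_stone_cech topspace_subtopology_stone_cech by blast
next
  assume R: ?R
  \<comment> \<open>The union of all basic open sets whose trace on \<open>S\<close> lies in
    \<open>U\<close>.\<close>
  let ?V = "{p. ultrafilter p \<and>
    (\<exists>A. contains p A \<and> (\<forall>q\<in>S. ultrafilter q \<longrightarrow> contains q A \<longrightarrow> q \<in> U))}"
  have "openin stone_cech ?V"
    unfolding openin_stone_cech by blast
  moreover have "U = ?V \<inter> S"
    using R unfolding topspace_subtopology_stone_cech by blast
  ultimately show "openin (subtopology stone_cech S) U"
    unfolding openin_subtopology by blast
qed

lemmas openin_remainder =
  openin_subtopology_stone_cech[of "- range (\<lambda>x. principal {x})", folded stone_cech_remainder_def]

section \<open>Neighborhood bases and bases of filters\<close>

lemma nbhd_baseD: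
  assumes "nbhd_base T t \<B>"
  shows "N \<in> \<B> \<Longrightarrow> \<exists>U. openin T U \<and> t \<in> U \<and> U \<subseteq> N"
    and "openin T U \<Longrightarrow> t \<in> U \<Longrightarrow> \<exists>N\<in>\<B>. N \<subseteq> U"
  using assms by (simp_all add: nbhd_base_def)

lemma character_le:
  assumes "nbhd_base T t \<B>"
  shows "character T t \<le>o |\<B>|"
  unfolding character_def
  by (rule cleast(2)) (use assms in \<open>auto simp: card_of_Card_order\<close>)

lemma Card_order_character: "Card_order (character T t)"
  by (metis character_witness card_of_Card_order)

lemma min_character_le: "t \<in> topspace T \<Longrightarrow> min_character T \<le>o character T t"
  unfolding min_character_def by (rule cleast(2)) (auto simp: Card_order_character)

lemma min_character_witness:
  assumes "topspace T \<noteq> {}"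
  obtains t \<B> where "t \<in> topspace T" "nbhd_base T t \<B>" "min_character T = |\<B>|"
proof -
  have "min_character T \<in> character T ` topspace T"
    unfolding min_character_def by (rule cleast(1)) (use assms Card_order_character in auto)
  then show thesis
    using that character_witness by (metis imageE)
qed

text \<open>Bases will be given as indexed families; repetitions can only make the base smaller than
  its index set.\<close>

lemma min_character_le_card:
  assumes "t \<in> topspace T" "nbhd_base T t (N ` I)"
  shows "min_character T \<le>o |I|"
  using min_character_le[OF assms(1)] character_le[OF assms(2)] card_of_image
  by (metis ordLeq_transitive)

text \<open>A nonprincipal ultrafilter omits every singleton, hence every finite set; conversely the
  cofinite set avoiding \<open>x\<close> separates it from the principal ultrafilter at
  \<open>x\<close>.\<close>

lemma topspace_remainder:
  "topspace stone_cech_remainder = {v :: nat filter. ultrafilter v \<and> v \<le> cofinite}"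
proof -
  have "v \<notin> range (\<lambda>x. principal {x}) \<longleftrightarrow> v \<le> cofinite" if v: "ultrafilter v" for v :: "nat filter"
  proof
    assume v': "v \<notin> range (\<lambda>x. principal {x})"
    have "contains v (- {x})" for x
    proof (rule ccontr)
      assume "\<not> contains v (- {x})"
      then have x: "contains v {x}" using ultrafilter_Compl[OF v] by blast
      have "v = principal {x}"
      proof (rule filter_eqI)
        fix P
        show "eventually P v = eventually P (principal {x})"
          using x ultrafilter_Compl[OF v, of "{x}"] unfolding eventually_principal
          by (auto elim: eventually_mono)
            (metis (mono_tags, lifting) ComplI eventually_mono singletonD)
      qed
      with v' show False by blast
    qed
    then have *: "\<forall>\<^sub>F y in v. \<forall>x\<in>F. y \<noteq> x" if "finite F" for F
      using that by (simp add: eventually_ball_finite)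
    show "v \<le> cofinite"
    proof (rule filter_leI)
      fix P assume "eventually P (cofinite :: nat filter)"
      then show "eventually P v"
        using *[of "{x. \<not> P x}"] by (auto simp: eventually_cofinite elim: eventually_mono)
    qed
  next
    assume le: "v \<le> cofinite"
    show "v \<notin> range (\<lambda>x. principal {x})"
    proof
      assume "v \<in> range (\<lambda>x. principal {x})"
      then obtain x where x: "v = principal {x}" by blast
      have "\<forall>\<^sub>F y in cofinite. y \<noteq> x" by (simp add: eventually_cofinite)
      then have "\<forall>\<^sub>F y in v. y \<noteq> x" using le by (rule filter_leD[rotated])
      then show False using x by (simp add: eventually_principal)
    qed
  qed
  then show ?thesis
    unfolding stone_cech_remainder_def topspace_subtopology_stone_cech by blast
qed

text \<open>Replaces neighborhoods by sets of integers that form a base of \<open>v\<close> modulo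
  finite sets. Were \<open>A N - S\<close> infinite, a free ultrafilter containing it would lie in
  \<open>N\<close> without containing \<open>S\<close>.\<close>

lemma remainder_base_sets:
  assumes "nbhd_base stone_cech_remainder v \<B>" "v \<in> topspace stone_cech_remainder"
  obtains A :: "nat filter set \<Rightarrow> nat set" where
    "\<And>N. N \<in> \<B> \<Longrightarrow> contains v (A N)"
    "\<And>S. contains v S \<Longrightarrow> \<exists>N\<in>\<B>. finite (A N - S)"
proof -
  let ?T = "topspace (stone_cech_remainder :: nat filter topology)"
  have "\<exists>A. contains v A \<and> (\<forall>q\<in>?T. contains q A \<longrightarrow> q \<in> N)" if "N \<in> \<B>" for N
  proof -
    from nbhd_baseD(1)[OF assms(1) that]
    obtain U where U: "openin stone_cech_remainder U" "v \<in> U" "U \<subseteq> N" by blast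
    then show ?thesis unfolding openin_remainder by blast
  qed
  then obtain A where A: "contains v (A N)" "q \<in> ?T \<Longrightarrow> contains q (A N) \<Longrightarrow> q \<in> N"
    if "N \<in> \<B>" for N q by metis
  show thesis
  proof (rule that)
    fix S assume S: "contains v S"
    have "openin stone_cech_remainder {q \<in> ?T. contains q S}"
      unfolding openin_remainder by blast
    then obtain N where N: "N \<in> \<B>" "N \<subseteq> {q \<in> ?T. contains q S}"
      using nbhd_baseD(2)[OF assms(1)] assms(2) S by blast
    have "finite (A N - S)"
    proof (rule ccontr)
      assume "infinite (A N - S)"
      then have "\<not> contains cofinite (- (A N - S))" by (simp add: eventually_cofinite Collect_conj_eq[symmetric] set_diff_eq)
      then obtain q where q: "ultrafilter q" "q \<le> cofinite" "contains q (A N - S)"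
        by (rule le_ultrafilter_contains)
      then have "q \<in> ?T" by (simp add: topspace_remainder)
      moreover have "contains q (A N)" "contains q (- S)"
        using q(3) by (auto elim: eventually_mono)
      ultimately show False
        using A(2) N ultrafilter_Compl[OF q(1), of S] by blast
    qed
    with N show "\<exists>N\<in>\<B>. finite (A N - S)" by blast
  qed (rule A)
qed

text \<open>The converse passage: free ultrafilters do not see finite errors, so a base modulo
  finite sets yields a neighborhood base at \<open>v\<close>.\<close>

lemma remainder_min_character_le:
  assumes "ultrafilter v" "v \<le> cofinite"
    and "\<And>i. i \<in> I \<Longrightarrow> contains v (A i :: nat set)"
    and "\<And>S. contains v S \<Longrightarrow> \<exists>i\<in>I. finite (A i - S)"
  shows "cardinal_u \<le>o |I|"
  unfolding cardinal_u_def
proof (rule min_character_le_card)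
  let ?T = "topspace (stone_cech_remainder :: nat filter topology)"
  show v: "v \<in> ?T" using assms by (simp add: topspace_remainder)
  have op: "openin stone_cech_remainder {q \<in> ?T. contains q S}" for S
    unfolding openin_remainder by blast
  show "nbhd_base stone_cech_remainder v ((\<lambda>i. {q \<in> ?T. contains q (A i)}) ` I)"
    unfolding nbhd_base_def
  proof (intro conjI ballI allI impI)
    fix N assume "N \<in> (\<lambda>i. {q \<in> ?T. contains q (A i)}) ` I"
    then show "N \<subseteq> ?T" "\<exists>U. openin stone_cech_remainder U \<and> v \<in> U \<and> U \<subseteq> N"
      using op v assms(3) by blast+
  next
    fix U assume "openin stone_cech_remainder U \<and> v \<in> U"
    then obtain S where S: "contains v S" "\<And>q. q \<in> ?T \<Longrightarrow> contains q S \<Longrightarrow> q \<in> U"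
      unfolding openin_remainder by blast
    obtain i where i: "i \<in> I" "finite (A i - S)" using assms(4)[OF S(1)] by blast
    have "contains q S" if q: "q \<in> ?T" "contains q (A i)" for q
    proof -
      have "contains cofinite (- (A i - S))" using i by (simp add: eventually_cofinite Collect_conj_eq[symmetric] set_diff_eq)
      then have "contains q (- (A i - S))" using q(1) by (auto simp: topspace_remainder intro: filter_leD)
      with q(2) show ?thesis by eventually_elim auto
    qed
    then have "{q \<in> ?T. contains q (A i)} \<subseteq> U" using S(2) by auto
    then show "\<exists>N\<in>(\<lambda>i. {q \<in> ?T. contains q (A i)}) ` I. N \<subseteq> U"
      using i(1) by (rule bexI[OF _ imageI])
  qed
qed

section \<open>Asymptotic disjointness and the corona relation\<close>

text \<open>Bounding the part of \<open>P\<close> near \<open>Q\<close> is a one-sided form of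
  bounding the intersection of neighborhoods. The part of \<open>Q\<close> near \<open>P\<close>
  lies within \<epsilon> of it, whence the symmetry.\<close>

definition asym_disjoint :: "'a::metric_space set \<Rightarrow> 'a set \<Rightarrow> bool" where
  "asym_disjoint P Q \<longleftrightarrow> (\<forall>\<epsilon>. bounded {x \<in> P. \<exists>y\<in>Q. dist x y \<le> \<epsilon>})"

lemma asym_disjointD: "asym_disjoint P Q \<Longrightarrow> bounded {x \<in> P. \<exists>y\<in>Q. dist x y \<le> \<epsilon>}"
  by (simp add: asym_disjoint_def)

lemma asym_disjoint_mono:
  assumes "asym_disjoint P Q" "P' \<subseteq> P" "Q' \<subseteq> Q"
  shows "asym_disjoint P' Q'"
  unfolding asym_disjoint_def
proof
  fix \<epsilon>
  show "bounded {x \<in> P'. \<exists>y\<in>Q'. dist x y \<le> \<epsilon>}"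
    by (rule bounded_subset[OF asym_disjointD[OF assms(1)]]) (use assms in blast)
qed

lemma asym_disjoint_sym:
  assumes "asym_disjoint P Q"
  shows "asym_disjoint Q P"
  unfolding asym_disjoint_def
proof
  fix \<epsilon>
  let ?B = "{x \<in> P. \<exists>y\<in>Q. dist x y \<le> \<epsilon>}"
  obtain a e where "\<forall>x\<in>?B. dist a x \<le> e"
    using asym_disjointD[OF assms] unfolding bounded_def by blast
  then have "dist a y \<le> e + \<epsilon>" if "y \<in> Q" "x \<in> P" "dist y x \<le> \<epsilon>" for x y
    using that dist_triangle[of a y x] by (force simp: dist_commute)
  then show "bounded {x \<in> Q. \<exists>y\<in>P. dist x y \<le> \<epsilon>}"
    unfolding bounded_def by (intro exI[of _ a] exI[of _ "e + \<epsilon>"]) blast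
qed

lemma asym_disjoint_Un:
  assumes "asym_disjoint P Q" "asym_disjoint P R"
  shows "asym_disjoint P (Q \<union> R)"
  unfolding asym_disjoint_def
proof
  fix \<epsilon>
  have "bounded ({x \<in> P. \<exists>y\<in>Q. dist x y \<le> \<epsilon>} \<union> {x \<in> P. \<exists>y\<in>R. dist x y \<le> \<epsilon>})"
    using assms by (simp add: asym_disjointD)
  then show "bounded {x \<in> P. \<exists>y\<in>Q \<union> R. dist x y \<le> \<epsilon>}"
    by (rule bounded_subset) blast
qed

lemma asym_disjoint_bounded: "bounded P \<Longrightarrow> asym_disjoint P Q"
  by (auto simp: asym_disjoint_def intro: bounded_subset)

lemma asym_disjoint_Int: "asym_disjoint P Q \<Longrightarrow> bounded (P \<inter> Q)"
  using asym_disjointD[of P Q 0] by (rule bounded_subset) auto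

text \<open>Normality; it is what makes the closure of the parallel relation transitive.\<close>

lemma asym_disjoint_separate:
  assumes "asym_disjoint S T"
  obtains M where "asym_disjoint M S" "asym_disjoint (- M) T"
proof
  \<comment> \<open>The points at least as close to \<open>T\<close> as to \<open>S\<close>, phrased
    without infima of distances. A point of \<open>?M\<close> near \<open>S\<close>, or of its
    complement near \<open>T\<close>, is near both sets.\<close>
  let ?M = "{x. \<forall>s\<in>S. \<exists>t\<in>T. dist x t \<le> dist x s}"
  have near: "bounded {x. \<exists>s\<in>S. \<exists>t\<in>T. dist x s \<le> \<epsilon> \<and> dist x t \<le> \<epsilon>}" for \<epsilon>
  proof -
    obtain a e where e: "\<forall>x\<in>{x \<in> S. \<exists>y\<in>T. dist x y \<le> 2 * \<epsilon>}. dist a x \<le> e"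
      using asym_disjointD[OF assms] unfolding bounded_def by blast
    have "dist a x \<le> e + \<epsilon>" if "s \<in> S" "t \<in> T" "dist x s \<le> \<epsilon>" "dist x t \<le> \<epsilon>" for x s t
    proof -
      have "dist s t \<le> 2 * \<epsilon>"
        using that dist_triangle[of s t x] by (simp add: dist_commute)
      then have "dist a s \<le> e" using e that by blast
      then show ?thesis using that dist_triangle[of a x s] by (simp add: dist_commute)
    qed
    then show ?thesis
      unfolding bounded_def by (intro exI[of _ a] exI[of _ "e + \<epsilon>"]) blast
  qed
  show "asym_disjoint ?M S"
    unfolding asym_disjoint_def
  proof
    fix \<epsilon>
    show "bounded {x \<in> ?M. \<exists>y\<in>S. dist x y \<le> \<epsilon>}"
    proof (rule bounded_subset[OF near[of \<epsilon>]], rule subsetI)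
      fix x assume "x \<in> {x \<in> ?M. \<exists>y\<in>S. dist x y \<le> \<epsilon>}"
      then obtain s t where "s \<in> S" "dist x s \<le> \<epsilon>" "t \<in> T" "dist x t \<le> dist x s" by blast
      then show "x \<in> {x. \<exists>s\<in>S. \<exists>t\<in>T. dist x s \<le> \<epsilon> \<and> dist x t \<le> \<epsilon>}"
        using order_trans by blast
    qed
  qed
  show "asym_disjoint (- ?M) T"
    unfolding asym_disjoint_def
  proof
    fix \<epsilon>
    show "bounded {x \<in> - ?M. \<exists>y\<in>T. dist x y \<le> \<epsilon>}"
    proof (rule bounded_subset[OF near[of \<epsilon>]], rule subsetI)
      fix x assume "x \<in> {x \<in> - ?M. \<exists>y\<in>T. dist x y \<le> \<epsilon>}"
      then obtain s t where st: "t \<in> T" "dist x t \<le> \<epsilon>" "s \<in> S" "\<not> dist x t \<le> dist x s" by blast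
      then have "dist x s \<le> \<epsilon>" by linarith
      with st show "x \<in> {x. \<exists>s\<in>S. \<exists>t\<in>T. dist x s \<le> \<epsilon> \<and> dist x t \<le> \<epsilon>}" by blast
    qed
  qed
qed

text \<open>The intersection of the ultrafilters in the class of \<open>p\<close> in the corona, see
  \<open>corona_rel_iff\<close>.\<close>

definition corona_filter :: "'a::metric_space filter \<Rightarrow> 'a filter" where
  "corona_filter p = Abs_filter (\<lambda>R. \<exists>P. contains p P \<and> asym_disjoint P {x. \<not> R x})"

lemma eventually_corona_filter:
  "eventually R (corona_filter p) \<longleftrightarrow> (\<exists>P. contains p P \<and> asym_disjoint P {x. \<not> R x})"
  unfolding corona_filter_def
proof (rule eventually_Abs_filter, rule is_filter.intro)
  show "\<exists>P. contains p P \<and> asym_disjoint P {x. \<not> True}"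
    by (intro exI[of _ UNIV]) (simp add: asym_disjoint_def)
next
  fix R R'
  assume "\<exists>P. contains p P \<and> asym_disjoint P {x. \<not> R x}"
    and "\<exists>P. contains p P \<and> asym_disjoint P {x. \<not> R' x}"
  then obtain P P' where "contains p P" "asym_disjoint P {x. \<not> R x}"
    "contains p P'" "asym_disjoint P' {x. \<not> R' x}" by blast
  then have "contains p (P \<inter> P')" "asym_disjoint (P \<inter> P') ({x. \<not> R x} \<union> {x. \<not> R' x})"
    unfolding contains_Int by (auto intro!: asym_disjoint_Un elim: asym_disjoint_mono)
  then show "\<exists>P. contains p P \<and> asym_disjoint P {x. \<not> (R x \<and> R' x)}"
    unfolding de_Morgan_conj Collect_disj_eq by (intro exI conjI)
next
  fix R R' :: "'a \<Rightarrow> bool"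
  assume "\<forall>x. R x \<longrightarrow> R' x" "\<exists>P. contains p P \<and> asym_disjoint P {x. \<not> R x}"
  then show "\<exists>P. contains p P \<and> asym_disjoint P {x. \<not> R' x}"
    by (blast intro: asym_disjoint_mono[OF _ subset_refl])
qed

lemma contains_corona_filter:
  "contains (corona_filter p) A \<longleftrightarrow> (\<exists>P. contains p P \<and> asym_disjoint P (- A))"
  by (simp add: eventually_corona_filter Compl_eq)

section \<open>Corona filters and the class of an ultrafilter\<close>

lemma topspace_sharp:
  "topspace sharp = {p. ultrafilter p \<and> (\<forall>B. bounded B \<longrightarrow> contains p (- B))}"
  unfolding sharp_def topspace_subtopology_stone_cech by blast

lemma openin_sharp:
  "openin sharp U \<longleftrightarrow> U \<subseteq> topspace sharp \<and>
     (\<forall>p\<in>U. \<exists>A. contains p A \<and> (\<forall>q\<in>topspace sharp. contains q A \<longrightarrow> q \<in> U))"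
  unfolding sharp_def by (rule openin_subtopology_stone_cech)

lemma openin_sharp_contains: "openin sharp {p \<in> topspace sharp. contains p A}"
  unfolding openin_sharp by blast

lemma sharp_bounded: "p \<in> topspace sharp \<Longrightarrow> bounded B \<Longrightarrow> contains p (- B)"
  unfolding topspace_sharp by blast

lemma sharp_contains_not_bounded:
  assumes "p \<in> topspace sharp" "contains p A"
  shows "\<not> bounded A"
proof
  assume "bounded A"
  then have "contains p (- A)" "ultrafilter p" using assms by (auto simp: topspace_sharp)
  then show False using assms(2) ultrafilter_Compl by blast
qed

lemma corona_filter_bounded: "bounded B \<Longrightarrow> contains (corona_filter p) (- B)"
  unfolding contains_corona_filter
  by (intro exI[of _ UNIV]) (auto intro: asym_disjoint_sym asym_disjoint_bounded)

text \<open>A form symmetric in the two ultrafilters, from which the properties of an equivalence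
  relation can be read off.\<close>

lemma le_corona_filter_iff:
  assumes "ultrafilter p" "ultrafilter q"
  shows "q \<le> corona_filter p \<longleftrightarrow>
    (\<forall>P Q. contains p P \<longrightarrow> contains q Q \<longrightarrow> \<not> asym_disjoint P Q)"
proof
  assume le: "q \<le> corona_filter p"
  show "\<forall>P Q. contains p P \<longrightarrow> contains q Q \<longrightarrow> \<not> asym_disjoint P Q"
  proof (intro allI impI notI)
    fix P Q assume *: "contains p P" "contains q Q" "asym_disjoint P Q"
    then have "contains (corona_filter p) (- Q)"
      unfolding contains_corona_filter by auto
    then have "contains q (- Q)" using le by (rule filter_leD[rotated])
    then show False using ultrafilter_Compl[OF assms(2)] *(2) by blast
  qed
next
  assume *: "\<forall>P Q. contains p P \<longrightarrow> contains q Q \<longrightarrow> \<not> asym_disjoint P Q"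
  show "q \<le> corona_filter p"
  proof (rule filter_leI)
    fix R assume "eventually R (corona_filter p)"
    then obtain P where P: "contains p P" "asym_disjoint P {x. \<not> R x}"
      unfolding eventually_corona_filter by blast
    have "{x. \<not> R x} = - {x. R x}" by blast
    with P * have "\<not> contains q (- {x. R x})" by auto
    then show "eventually R q"
      using ultrafilter_Compl[OF assms(2), of "{x. R x}"] by simp
  qed
qed

lemma le_corona_filter_sharp:
  assumes "ultrafilter q" "q \<le> corona_filter p"
  shows "q \<in> topspace sharp"
  using assms corona_filter_bounded[of _ p] by (auto simp: topspace_sharp intro: filter_leD)

lemma sharp_le_corona_filter:
  assumes "p \<in> topspace sharp"
  shows "p \<le> corona_filter p"
proof -
  have p: "ultrafilter p" using assms by (simp add: topspace_sharp)
  show ?thesis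
    unfolding le_corona_filter_iff[OF p p]
    by (metis asym_disjoint_Int contains_Int sharp_contains_not_bounded[OF assms])
qed

lemma le_corona_filter_sym:
  assumes "ultrafilter p" "ultrafilter q" "q \<le> corona_filter p"
  shows "p \<le> corona_filter q"
  using assms(3) asym_disjoint_sym
  unfolding le_corona_filter_iff[OF assms(1,2)] le_corona_filter_iff[OF assms(2,1)] by blast

text \<open>If \<open>P\<close> and \<open>R\<close> were asymptotically disjoint, normality would
  give a set \<open>M\<close> such that \<open>q\<close> can contain neither \<open>M\<close> nor
  its complement.\<close>

lemma le_corona_filter_trans:
  assumes "ultrafilter p" "ultrafilter q" "ultrafilter r"
    and "q \<le> corona_filter p" "r \<le> corona_filter q"
  shows "r \<le> corona_filter p"
  unfolding le_corona_filter_iff[OF assms(1,3)]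
proof (intro allI impI notI)
  fix P R assume *: "contains p P" "contains r R" "asym_disjoint P R"
  obtain M where M: "asym_disjoint M P" "asym_disjoint (- M) R"
    using asym_disjoint_separate[OF *(3)] .
  have "\<not> contains q M"
    using assms(4) * asym_disjoint_sym[OF M(1)] unfolding le_corona_filter_iff[OF assms(1,2)] by blast
  moreover have "\<not> contains q (- M)"
    using assms(5) * M(2) unfolding le_corona_filter_iff[OF assms(2,3)] by blast
  ultimately show False using ultrafilter_Compl[OF assms(2)] by blast
qed


text \<open>The sets \<open>Q\<close> and \<open>set_nbhd \<epsilon> P\<close> both belong to
  \<open>q\<close>, so their intersection is unbounded; it is the part of \<open>Q\<close> within
  \<epsilon> of \<open>P\<close>.\<close>

lemma parallel_le_corona_filter:
  assumes "(p, q) \<in> parallel"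
  shows "q \<le> corona_filter p"
proof -
  obtain \<epsilon> where pq: "p \<in> topspace sharp" "q \<in> topspace sharp"
    and \<epsilon>: "\<And>P. contains p P \<Longrightarrow> contains q (set_nbhd \<epsilon> P)"
    using assms unfolding parallel_def by blast
  then have u: "ultrafilter p" "ultrafilter q" by (simp_all add: topspace_sharp)
  show ?thesis
    unfolding le_corona_filter_iff[OF u]
  proof (intro allI impI notI)
    fix P Q assume *: "contains p P" "contains q Q" "asym_disjoint P Q"
    have "contains q (Q \<inter> set_nbhd \<epsilon> P)"
      using \<epsilon>[OF *(1)] *(2) by (simp only: contains_Int)
    then have "\<not> bounded (Q \<inter> set_nbhd \<epsilon> P)" by (rule sharp_contains_not_bounded[OF pq(2)])
    moreover have "Q \<inter> set_nbhd \<epsilon> P = {x \<in> Q. \<exists>y\<in>P. dist x y \<le> \<epsilon>}"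
      by (auto simp: set_nbhd_def dist_commute)
    ultimately show False using asym_disjointD[OF asym_disjoint_sym[OF *(3)]] by simp
  qed
qed

lemma unbounded_sharp:
  assumes "\<not> bounded A"
  obtains p where "p \<in> topspace sharp" "contains p A"
proof -
  \<comment> \<open>\<open>corona_filter (principal UNIV)\<close> is the filter of sets with bounded
    complement.\<close>
  have "\<not> contains (corona_filter (principal UNIV)) (- A)"
  proof
    assume "contains (corona_filter (principal UNIV)) (- A)"
    then obtain P where "\<forall>x. x \<in> P" "asym_disjoint P A"
      unfolding contains_corona_filter eventually_principal by auto
    then show False using asym_disjoint_Int[of P A] assms by (simp add: Int_absorb1 subsetI)
  qed
  then obtain p where "ultrafilter p" "p \<le> corona_filter (principal UNIV)" "contains p A"
    by (rule le_ultrafilter_contains)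
  then show thesis using that le_corona_filter_sharp by blast
qed

text \<open>Some unbounded part of \<open>P\<close> can be moved into \<open>Q\<close> by a map
  \<open>f\<close> of displacement at most \<epsilon>. An ultrafilter in \<open>sharp\<close>
  containing that part is parallel to its image under \<open>f\<close>.\<close>

lemma not_asym_disjoint_parallel:
  assumes "\<not> asym_disjoint P Q"
  obtains p q where "(p, q) \<in> parallel" "contains p P" "contains q Q"
proof -
  obtain \<epsilon> where \<epsilon>: "\<not> bounded {x \<in> P. \<exists>y\<in>Q. dist x y \<le> \<epsilon>}" (is "\<not> bounded ?D")
    using assms by (auto simp: asym_disjoint_def)
  have "\<forall>x\<in>?D. \<exists>y. y \<in> Q \<and> dist x y \<le> \<epsilon>" by blast
  from bchoice[OF this]
  obtain f where "\<forall>x\<in>?D. f x \<in> Q \<and> dist x (f x) \<le> \<epsilon>" by blast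
  then have f: "f x \<in> Q" "dist x (f x) \<le> \<epsilon>" if "x \<in> ?D" for x using that by blast+
  from unbounded_sharp[OF \<epsilon>] obtain p where ps: "p \<in> topspace sharp" and pD: "contains p ?D" .
  have p: "ultrafilter p" using ps by (simp add: topspace_sharp)
  let ?q = "filtermap f p"
  have to_q: "contains ?q B" if "contains p A" "\<And>x. x \<in> A \<Longrightarrow> x \<in> ?D \<Longrightarrow> f x \<in> B" for A B
    using that(1) pD unfolding eventually_filtermap by eventually_elim (rule that(2))
  have from_q: "contains p A" if "contains ?q B" "\<And>x. f x \<in> B \<Longrightarrow> x \<in> ?D \<Longrightarrow> x \<in> A" for A B
    using that(1) pD unfolding eventually_filtermap by eventually_elim (rule that(2))
  have "contains ?q (- B)" if B: "bounded B" for B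
  proof -
    obtain a e where "\<forall>x\<in>B. dist a x \<le> e" using B unfolding bounded_def by blast
    then have "dist a x \<le> e + \<epsilon>" if "f x \<in> B" "x \<in> ?D" for x
      using f(2)[OF that(2)] that dist_triangle[of a x "f x"] by (force simp: dist_commute)
    then have *: "f x \<in> - B" if "x \<in> - cball a (e + \<epsilon>)" "x \<in> ?D" for x
      using that by force
    have "contains p (- cball a (e + \<epsilon>))" using ps by (rule sharp_bounded) simp
    then show ?thesis using * by (rule to_q)
  qed
  then have qs: "?q \<in> topspace sharp"
    using p by (simp add: topspace_sharp ultrafilter_filtermap)
  \<comment> \<open>The relation \<open>parallel\<close> asks for a positive radius, while
    \<epsilon> may be 0.\<close>
  have "contains ?q (set_nbhd (max \<epsilon> 1) A)" if "contains p A" for A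
    using that by (rule to_q) (use f in \<open>force simp: set_nbhd_def\<close>)
  moreover have "contains p (set_nbhd (max \<epsilon> 1) B)" if "contains ?q B" for B
    using that by (rule from_q) (use f in \<open>force simp: set_nbhd_def dist_commute\<close>)
  ultimately have "(p, ?q) \<in> parallel"
    unfolding parallel_def using ps qs by (auto intro!: exI[of _ "max \<epsilon> 1"])
  moreover have "contains p P" using pD by (rule contains_mono) blast
  moreover have "contains ?q Q" using pD by (rule to_q) (use f in blast)
  ultimately show thesis using that by blast
qed

text \<open>A pair outside the relation has asymptotically disjoint members, and these define an
  open box that misses the relation.\<close>

lemma closedin_asym:
  "closedin (prod_topology sharp sharp)
    {(p, q). p \<in> topspace sharp \<and> q \<in> topspace sharp \<and> q \<le> corona_filter p}"
    (is "closedin _ ?E")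
  unfolding closedin_def topspace_prod_topology
proof (intro conjI)
  let ?S = "topspace sharp"
  show "openin (prod_topology sharp sharp) (?S \<times> ?S - ?E)"
    unfolding openin_prod_topology_alt
  proof (intro allI impI)
    fix p q assume "(p, q) \<in> ?S \<times> ?S - ?E"
    then have pq: "p \<in> ?S" "q \<in> ?S" "\<not> q \<le> corona_filter p" by auto
    then obtain P Q where PQ: "contains p P" "contains q Q" "asym_disjoint P Q"
      by (auto simp: topspace_sharp le_corona_filter_iff)
    have "\<not> q' \<le> corona_filter p'" if "p' \<in> ?S" "q' \<in> ?S" "contains p' P" "contains q' Q" for p' q'
      using that PQ(3) by (auto simp: topspace_sharp le_corona_filter_iff)
    with pq PQ show "\<exists>U V. openin sharp U \<and> openin sharp V \<and> p \<in> U \<and> q \<in> V \<and> U \<times> V \<subseteq> ?S \<times> ?S - ?E"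
      by (intro exI[of _ "{p' \<in> ?S. contains p' P}"] exI[of _ "{p' \<in> ?S. contains p' Q}"])
        (auto intro: openin_sharp_contains)
  qed
qed auto

text \<open>The right-hand side is a closed equivalence relation containing \<open>parallel\<close>.
  It is also the smallest: by \<open>not_asym_disjoint_parallel\<close>, every basic box around such
  a pair contains a parallel pair, so closedness forces the pair into
  \<open>corona_rel\<close>.\<close>

lemma corona_rel_iff:
  fixes p q :: "'a::metric_space filter"
  shows "(p, q) \<in> corona_rel \<longleftrightarrow> p \<in> topspace sharp \<and> ultrafilter q \<and> q \<le> corona_filter p"
proof -
  let ?S = "topspace (sharp :: 'a filter topology)"
  let ?E = "{(p, q). p \<in> ?S \<and> q \<in> ?S \<and> q \<le> corona_filter p}"
  have uf: "r \<in> ?S \<Longrightarrow> ultrafilter r" for r by (simp add: topspace_sharp)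
  have "equiv ?S ?E"
  proof (rule equivI)
    show "refl_on ?S ?E" by (auto simp: refl_on_def sharp_le_corona_filter)
    show "sym ?E" by (auto simp: sym_def intro: le_corona_filter_sym uf)
    show "trans ?E" by (auto simp: trans_def intro: le_corona_filter_trans uf)
  qed auto
  moreover have "parallel \<subseteq> ?E"
    using parallel_le_corona_filter by (auto simp: parallel_def)
  ultimately have "corona_rel \<subseteq> ?E"
    unfolding corona_rel_def using closedin_asym by (intro Inter_lower) blast
  moreover have "?E \<subseteq> corona_rel"
  proof
    fix z assume "z \<in> ?E"
    then obtain p q where z: "z = (p, q)" and pq: "p \<in> ?S" "q \<in> ?S" "q \<le> corona_filter p" by blast
    show "z \<in> corona_rel"
    proof (rule ccontr)
      assume "z \<notin> corona_rel"
      then have "(p, q) \<in> ?S \<times> ?S - corona_rel" using z pq by blast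
      moreover have "openin (prod_topology sharp sharp) (?S \<times> ?S - corona_rel)"
        using corona_rel(2) unfolding closedin_def topspace_prod_topology by (rule conjunct2)
      ultimately obtain U V where UV: "openin sharp U" "openin sharp V" "p \<in> U" "q \<in> V"
        "U \<times> V \<subseteq> ?S \<times> ?S - corona_rel"
        unfolding openin_prod_topology_alt by meson
      then obtain P Q where PQ: "contains p P" "\<And>p'. p' \<in> ?S \<Longrightarrow> contains p' P \<Longrightarrow> p' \<in> U"
        "contains q Q" "\<And>q'. q' \<in> ?S \<Longrightarrow> contains q' Q \<Longrightarrow> q' \<in> V"
        unfolding openin_sharp by meson
      have "\<not> asym_disjoint P Q"
        using pq PQ le_corona_filter_iff uf by blast
      then obtain p' q' where p'q': "(p', q') \<in> parallel" "contains p' P" "contains q' Q"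
        by (rule not_asym_disjoint_parallel)
      then have "(p', q') \<in> U \<times> V" using PQ by (auto simp: parallel_def)
      then show False using UV(5) p'q'(1) corona_rel(3) by blast
    qed
  qed
  ultimately have "corona_rel = ?E" by blast
  then show ?thesis using le_corona_filter_sharp uf by blast
qed

section \<open>Neighborhoods in the corona\<close>

lemma ultrafilter_finite_Union:
  assumes "ultrafilter p" "finite X" "contains p (\<Union>X)"
  shows "\<exists>B\<in>X. contains p B"
  using assms(2,3)
proof induction
  case empty
  then show ?case using ultrafilter_nonempty[OF assms(1), of "{}"] by simp
next
  case (insert B X)
  then have "contains p (B \<union> \<Union>X)" by simp
  then show ?case using ultrafilter_Un[OF assms(1)] insert.IH by blast
qed

lemma contains_corona_filter_ultrafilters:
  "contains (corona_filter p) A \<longleftrightarrow>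
    (\<forall>q. ultrafilter q \<longrightarrow> q \<le> corona_filter p \<longrightarrow> contains q A)"
proof
  assume *: "\<forall>q. ultrafilter q \<longrightarrow> q \<le> corona_filter p \<longrightarrow> contains q A"
  show "contains (corona_filter p) A"
  proof (rule ccontr)
    assume "\<not> contains (corona_filter p) A"
    then have "\<not> contains (corona_filter p) (- (- A))" by simp
    then obtain q where q: "ultrafilter q" "q \<le> corona_filter p" "contains q (- A)"
      by (rule le_ultrafilter_contains)
    then show False using * ultrafilter_Compl[OF q(1)] by blast
  qed
qed (auto intro: filter_leD)

lemma topspace_corona: "topspace corona = topspace sharp // corona_rel"
  unfolding corona_def by (rule topspace_quotient_topology)

lemma corona_class:
  "p \<in> topspace sharp \<Longrightarrow> q \<in> corona_rel `` {p} \<longleftrightarrow> ultrafilter q \<and> q \<le> corona_filter p"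
  by (simp add: corona_rel_iff)

lemma corona_class_refl: "p \<in> topspace sharp \<Longrightarrow> p \<in> corona_rel `` {p}"
  using corona_class[of p p] sharp_le_corona_filter by (auto simp: topspace_sharp)

text \<open>A class lies in this set iff its corona filter contains \<open>A\<close>. The member
  \<open>P\<close> witnessing this for one ultrafilter witnesses it for all ultrafilters of
  \<open>sharp\<close> containing \<open>P\<close>.\<close>

lemma openin_corona_contains:
  "openin corona {c \<in> topspace corona. \<forall>q\<in>c. contains q A}" (is "openin corona ?N")
proof -
  have mem: "corona_rel `` {t} \<in> ?N \<longleftrightarrow> contains (corona_filter t) A" if "t \<in> topspace sharp" for t
    using that unfolding contains_corona_filter_ultrafilters topspace_corona
    by (auto simp: corona_rel_iff intro: quotientI)
  have "openin sharp {t \<in> topspace sharp. corona_rel `` {t} \<in> ?N}"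
    unfolding openin_sharp
  proof (intro conjI ballI)
    fix t assume "t \<in> {t \<in> topspace sharp. corona_rel `` {t} \<in> ?N}"
    then obtain P where P: "contains t P" "asym_disjoint P (- A)"
      using mem unfolding contains_corona_filter by blast
    then have "corona_rel `` {q} \<in> ?N" if "q \<in> topspace sharp" "contains q P" for q
      using that mem unfolding contains_corona_filter by blast
    with P show "\<exists>P. contains t P \<and> (\<forall>q\<in>topspace sharp. contains q P \<longrightarrow>
        q \<in> {t \<in> topspace sharp. corona_rel `` {t} \<in> ?N})" by blast
  qed blast
  then show ?thesis
    unfolding corona_def openin_quotient_topology topspace_quotient_topology by blast
qed

text \<open>The class of \<open>p\<close> is compact, so finitely many basic sets inside the preimage of \<open>U\<close> cover it.\<close>

lemma openin_corona_filter:
  assumes "openin corona U" "p \<in> topspace sharp" "corona_rel `` {p} \<in> U"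
  obtains A where "contains (corona_filter p) A"
    "\<And>q. q \<in> topspace sharp \<Longrightarrow> contains q A \<Longrightarrow> corona_rel `` {q} \<in> U"
proof -
  let ?V = "{t \<in> topspace sharp. corona_rel `` {t} \<in> U}"
  let ?\<N> = "{B. \<forall>q\<in>topspace sharp. contains q B \<longrightarrow> q \<in> ?V}"
  let ?F = "inf (corona_filter p) (INF B\<in>?\<N>. principal (- B))"
  have V: "openin sharp ?V"
    using assms(1) unfolding corona_def openin_quotient_topology by blast
  \<comment> \<open>An ultrafilter below \<open>?F\<close> would belong to the class of
    \<open>p\<close>, hence to the open set \<open>?V\<close>, yet would omit every basic set
    contained in \<open>?V\<close>.\<close>
  have "?F = bot"
  proof (rule ccontr)
    assume "?F \<noteq> bot"
    then obtain q where q: "ultrafilter q" "q \<le> ?F" by (rule le_ultrafilter)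
    have "q \<le> corona_filter p" using q(2) by simp
    then have pq: "(p, q) \<in> corona_rel" and qs: "q \<in> topspace sharp"
      using q(1) assms(2) le_corona_filter_sharp by (auto simp: corona_rel_iff)
    have "corona_rel `` {q} = corona_rel `` {p}"
      using equiv_class_eq[OF corona_rel(1) pq] by simp
    then have "q \<in> ?V" using qs assms(3) by simp
    then obtain B where B: "B \<in> ?\<N>" "contains q B" using V unfolding openin_sharp by blast
    have "q \<le> principal (- B)"
      using q(2) B(1) by (auto intro: order_trans INF_lower)
    then have "contains q (- B)" by (simp add: le_principal)
    with B(2) show False using ultrafilter_Compl[OF q(1)] by blast
  qed
  then have "\<forall>\<^sub>F x in ?F. False" by simp
  then obtain Q Q' where Q: "eventually Q (corona_filter p)"
    "eventually Q' (INF B\<in>?\<N>. principal (- B))" "\<And>x. Q x \<Longrightarrow> Q' x \<Longrightarrow> False"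
    unfolding eventually_inf by blast
  \<comment> \<open>Triviality of the infimum is witnessed by finitely many of its constituents;
    they form the finite subcover.\<close>
  obtain X where X: "X \<subseteq> ?\<N>" "finite X" "eventually Q' (INF B\<in>X. principal (- B))"
    using Q(2) unfolding eventually_INF[of _ _ ?\<N>] by blast
  have "Q' x" if "x \<notin> \<Union>X" for x
    using X(3) that by (simp add: INF_principal_finite[OF X(2)] eventually_principal)
  with Q(3) have sub: "Q x \<Longrightarrow> x \<in> \<Union>X" for x by blast
  show thesis
  proof
    show "contains (corona_filter p) (\<Union>X)"
      using Q(1) by (rule eventually_mono) (rule sub)
    fix q assume q: "q \<in> topspace sharp" "contains q (\<Union>X)"
    then have "ultrafilter q" by (simp add: topspace_sharp)
    then obtain B where "B \<in> X" "contains q B"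
      using ultrafilter_finite_Union[OF _ X(2) q(2)] by blast
    then show "corona_rel `` {q} \<in> U" using X(1) q(1) by blast
  qed
qed

text \<open>The analogue of \<open>remainder_base_sets\<close>, with bounded errors for finite ones:
  an unbounded \<open>A N - S\<close> would belong to some ultrafilter of \<open>sharp\<close> whose
  class lies in \<open>N\<close> although it omits \<open>S\<close>.\<close>

lemma corona_base_sets:
  fixes p :: "'a::metric_space filter"
  assumes "nbhd_base corona (corona_rel `` {p}) \<B>" "p \<in> topspace sharp"
  obtains A :: "'a::metric_space filter set set \<Rightarrow> 'a set" where
    "\<And>N. N \<in> \<B> \<Longrightarrow> contains (corona_filter p) (A N)"
    "\<And>S. contains (corona_filter p) S \<Longrightarrow> \<exists>N\<in>\<B>. bounded (A N - S)"
proof -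
  have "\<exists>A. contains (corona_filter p) A \<and>
      (\<forall>q\<in>topspace sharp. contains q A \<longrightarrow> corona_rel `` {q} \<in> N)" if N: "N \<in> \<B>" for N
  proof -
    obtain U where U: "openin corona U" "corona_rel `` {p} \<in> U" "U \<subseteq> N"
      using nbhd_baseD(1)[OF assms(1) N] by blast
    obtain A where "contains (corona_filter p) A"
      "\<And>q. q \<in> topspace sharp \<Longrightarrow> contains q A \<Longrightarrow> corona_rel `` {q} \<in> U"
      using openin_corona_filter[OF U(1) assms(2) U(2)] by blast
    with U(3) show ?thesis by blast
  qed
  then obtain A where A: "contains (corona_filter p) (A N)"
    "q \<in> topspace sharp \<Longrightarrow> contains q (A N) \<Longrightarrow> corona_rel `` {q} \<in> N" if "N \<in> \<B>" for N q
    by metis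
  show thesis
  proof (rule that)
    fix S assume "contains (corona_filter p) S"
    then have "corona_rel `` {p} \<in> {c \<in> topspace corona. \<forall>q\<in>c. contains q S}"
      using assms(2) by (auto simp: topspace_corona corona_rel_iff intro: quotientI filter_leD)
    then obtain N where N: "N \<in> \<B>" "N \<subseteq> {c \<in> topspace corona. \<forall>q\<in>c. contains q S}"
      using nbhd_baseD(2)[OF assms(1) openin_corona_contains] by blast
    have "bounded (A N - S)"
    proof (rule ccontr)
      assume "\<not> bounded (A N - S)"
      then obtain q where q: "q \<in> topspace sharp" "contains q (A N - S)"
        by (rule unbounded_sharp)
      then have uq: "ultrafilter q" by (simp add: topspace_sharp)
      have "contains q (A N)" "contains q (- S)"
        using q(2) by (auto elim: eventually_mono)
      then show False
        using A(2)[OF N(1) q(1)] N(2) corona_class_refl[OF q(1)] ultrafilter_Compl[OF uq] by blast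
    qed
    with N(1) show "\<exists>N\<in>\<B>. bounded (A N - S)" by blast
  qed (rule A(1))
qed

lemma corona_min_character_le:
  fixes p :: "'a::metric_space filter"
  assumes "p \<in> topspace sharp"
    and "\<And>i. i \<in> I \<Longrightarrow> contains (corona_filter p) (A i)"
    and "\<And>S. contains (corona_filter p) S \<Longrightarrow> \<exists>i\<in>I. bounded (A i - S)"
  shows "min_character (corona :: 'a filter set topology) \<le>o |I|"
proof (rule min_character_le_card)
  let ?c = "corona_rel `` {p}" and ?N = "\<lambda>S. {c \<in> topspace corona. \<forall>q\<in>c. contains q S}"
  show c: "?c \<in> topspace corona"
    using assms(1) by (auto simp: topspace_corona intro: quotientI)
  show "nbhd_base corona ?c ((\<lambda>i. ?N (A i)) ` I)"
    unfolding nbhd_base_def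
  proof (intro conjI ballI allI impI)
    fix M assume "M \<in> (\<lambda>i. ?N (A i)) ` I"
    then obtain i where i: "i \<in> I" "M = ?N (A i)" by blast
    then have "?c \<in> M"
      using assms(1,2) c by (auto simp: corona_rel_iff intro: filter_leD)
    then show "\<exists>U. openin corona U \<and> ?c \<in> U \<and> U \<subseteq> M"
      using openin_corona_contains[of "A i"] i(2) by blast
    show "M \<subseteq> topspace corona" using i(2) by blast
  next
    fix U assume U: "openin corona U \<and> ?c \<in> U"
    then obtain S where S: "contains (corona_filter p) S"
      "\<And>q. q \<in> topspace sharp \<Longrightarrow> contains q S \<Longrightarrow> corona_rel `` {q} \<in> U"
      using openin_corona_filter[of U p] assms(1) by blast
    obtain i where i: "i \<in> I" "bounded (A i - S)" using assms(3)[OF S(1)] by blast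
    have "?N (A i) \<subseteq> U"
    proof
      fix c assume c: "c \<in> ?N (A i)"
      then obtain q where q: "q \<in> topspace sharp" "c = corona_rel `` {q}"
        unfolding topspace_corona by (blast elim: quotientE)
      then have "contains q (A i)" using c corona_class_refl by blast
      moreover have "contains q (- (A i - S))" using q(1) i(2) by (rule sharp_bounded)
      ultimately have "contains q S" by eventually_elim blast
      then show "c \<in> U" using S(2) q by blast
    qed
    then show "\<exists>N\<in>(\<lambda>i. ?N (A i)) ` I. N \<subseteq> U" using i(1) by (rule bexI[OF _ imageI])
  qed
qed

text \<open>A point of least character, translated into a base of its corona filter modulo bounded
  sets: the starting point of both lower bounds. Its counterpart \<open>remainder_witness\<close>
  starts the upper bounds.\<close>

lemma corona_witness:
  assumes "\<not> bounded (UNIV :: 'a::metric_space set)"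
  obtains p :: "'a::metric_space filter" and \<B> :: "'a::metric_space filter set set set" and A where
    "p \<in> topspace sharp" "min_character (corona :: 'a filter set topology) = |\<B>|"
    "\<And>N. N \<in> \<B> \<Longrightarrow> contains (corona_filter p) (A N)"
    "\<And>S. contains (corona_filter p) S \<Longrightarrow> \<exists>N\<in>\<B>. bounded (A N - S)"
proof -
  obtain p\<^sub>0 :: "'a filter" where "p\<^sub>0 \<in> topspace sharp" using unbounded_sharp[OF assms] .
  then have "topspace (corona :: 'a filter set topology) \<noteq> {}"
    unfolding topspace_corona quotient_def by blast
  then obtain t and \<B> :: "'a filter set set set" where t: "t \<in> topspace corona"
    "nbhd_base corona t \<B>" "min_character (corona :: 'a filter set topology) = |\<B>|"
    by (rule min_character_witness)
  then obtain p where p: "p \<in> topspace sharp" "t = corona_rel `` {p}"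
    unfolding topspace_corona by (blast elim: quotientE)
  obtain A where "\<And>N. N \<in> \<B> \<Longrightarrow> contains (corona_filter p) (A N)"
    "\<And>S. contains (corona_filter p) S \<Longrightarrow> \<exists>N\<in>\<B>. bounded (A N - S)"
    using corona_base_sets[OF t(2)[unfolded p(2)] p(1)] by blast
  with that p(1) t(3) show thesis by blast
qed

lemma remainder_witness:
  obtains v :: "nat filter" and \<B> :: "nat filter set set" and A where
    "ultrafilter v" "v \<le> cofinite" "cardinal_u = |\<B>|"
    "\<And>N. N \<in> \<B> \<Longrightarrow> contains v (A N)"
    "\<And>S. contains v S \<Longrightarrow> \<exists>N\<in>\<B>. finite (A N - S)"
proof -
  obtain v\<^sub>0 :: "nat filter" where "ultrafilter v\<^sub>0" "v\<^sub>0 \<le> cofinite"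
    using le_ultrafilter[of "cofinite :: nat filter"] by auto
  then have "topspace (stone_cech_remainder :: nat filter topology) \<noteq> {}"
    by (auto simp: topspace_remainder)
  then obtain v \<B> where v: "v \<in> topspace stone_cech_remainder"
    "nbhd_base stone_cech_remainder v \<B>" "cardinal_u = |\<B>|"
    unfolding cardinal_u_def by (rule min_character_witness)
  obtain A where "\<And>N. N \<in> \<B> \<Longrightarrow> contains v (A N)"
    "\<And>S. contains v S \<Longrightarrow> \<exists>N\<in>\<B>. finite (A N - S)"
    using remainder_base_sets[OF v(2,1)] by blast
  with that v show thesis by (auto simp: topspace_remainder)
qed

section \<open>Comparison with the remainder of the natural numbers\<close>

text \<open>The function \<open>g x = ln (1 + dist z x)\<close> is slowly oscillating. Points with \<open>g x\<close> away from the integers or away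
  from the half-integers keep their distance from the places where rounding jumps.\<close>

lemma sharp_coarse_partition:
  fixes p :: "'a::metric_space filter"
  assumes p: "p \<in> topspace sharp"
  obtains \<phi> :: "'a \<Rightarrow> nat" and E where
    "contains p E" "\<And>n. bounded (\<phi> -` {n})" "\<And>B. bounded B \<Longrightarrow> finite (\<phi> ` B)"
    "\<And>\<epsilon>. bounded {x \<in> E. \<exists>y. dist x y \<le> \<epsilon> \<and> \<phi> y \<noteq> \<phi> x}"
proof -
  define z :: 'a where "z = undefined"
  define g where "g x = ln (1 + dist z x)" for x
  have g0: "0 \<le> g x" for x by (simp add: g_def)
  \<comment> \<open>If \<open>x\<close> is farther than 5\<epsilon> from \<open>z\<close>, then
    \<open>y\<close> is farther than 4\<epsilon>, so the mean value bound for \<open>ln\<close>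
    gives at most \<epsilon>/(1 + 4\<epsilon>) < 1/4.\<close>
  have osc: "\<bar>g x - g y\<bar> < 1 / 4" if d: "dist x y \<le> \<epsilon>" "5 * \<epsilon> < dist z x" for x y \<epsilon>
  proof -
    have \<epsilon>: "0 \<le> \<epsilon>" using d(1) zero_le_dist[of x y] by linarith
    have tri: "dist z x \<le> dist z y + \<epsilon>" "dist z y \<le> dist z x + \<epsilon>"
      using d(1) dist_triangle[of z x y] dist_triangle[of z y x] by (simp_all add: dist_commute)
    have "g x - g y \<le> ((1 + dist z x) - (1 + dist z y)) / (1 + dist z y)"
      unfolding g_def by (rule ln_diff_le) (use zero_le_dist[of z x] zero_le_dist[of z y] in linarith)+
    also have "\<dots> < 1 / 4"
      using tri d(2) zero_le_dist[of z y] by (simp add: field_simps)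
    finally have 1: "g x - g y < 1 / 4" .
    have "g y - g x \<le> ((1 + dist z y) - (1 + dist z x)) / (1 + dist z x)"
      unfolding g_def by (rule ln_diff_le) (use zero_le_dist[of z x] zero_le_dist[of z y] in linarith)+
    also have "\<dots> < 1 / 4"
      using tri d(2) \<epsilon> zero_le_dist[of z x] by (simp add: field_simps)
    finally show ?thesis using 1 by linarith
  qed
  \<comment> \<open>Here \<open>g x + c\<close> is at least 1/4 away from the integers. The shifts
    by 0 and 1/2 together cover the space, and \<open>p\<close> selects one of them.\<close>
  let ?E = "\<lambda>c. {x. 1 / 4 \<le> frac (g x + c) \<and> frac (g x + c) \<le> 3 / 4}"
  have "?E 0 \<union> ?E (1 / 2) = UNIV"
  proof -
    have "1 / 4 \<le> frac t \<and> frac t \<le> 3 / 4 \<or> 1 / 4 \<le> frac (t + 1 / 2) \<and> frac (t + 1 / 2) \<le> 3 / 4"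
      for t :: real
    proof -
      have "\<lfloor>t + 1 / 2\<rfloor> = \<lfloor>t\<rfloor> \<or> \<lfloor>t + 1 / 2\<rfloor> = \<lfloor>t\<rfloor> + 1" by linarith
      moreover have "\<lfloor>t\<rfloor> \<le> t" "t < \<lfloor>t\<rfloor> + 1" "\<lfloor>t + 1 / 2\<rfloor> \<le> t + 1 / 2" "t + 1 / 2 < \<lfloor>t + 1 / 2\<rfloor> + 1"
        by linarith+
      ultimately show ?thesis unfolding frac_def by (elim disjE) (simp_all, linarith+)
    qed
    then show ?thesis by auto
  qed
  moreover have "ultrafilter p" using p by (simp add: topspace_sharp)
  ultimately have "contains p (?E 0) \<or> contains p (?E (1 / 2))"
    using ultrafilter_Un[of p "?E 0" "?E (1 / 2)"] by simp
  then obtain c where c: "0 \<le> c" "contains p (?E c)"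
    using that[of 0] that[of "1 / 2"] by auto
  let ?\<phi> = "\<lambda>x. nat \<lfloor>g x + c\<rfloor>"
  show thesis
  proof (rule that[OF c(2), of ?\<phi>])
    fix n
    have "dist z x \<le> exp (real n + 1)" if "nat \<lfloor>g x + c\<rfloor> = n" for x
    proof -
      have "g x \<le> real n + 1" using that c(1) g0[of x] by linarith
      then have "exp (g x) \<le> exp (real n + 1)" by simp
      moreover have "exp (g x) = 1 + dist z x"
        unfolding g_def by (rule exp_ln) (use zero_le_dist[of z x] in linarith)
      ultimately show ?thesis by linarith
    qed
    then show "bounded (?\<phi> -` {n})"
      unfolding bounded_def by (intro exI[of _ z] exI[of _ "exp (real n + 1)"]) auto
  next
    fix B :: "'a set" assume "bounded B"
    then obtain e where e: "\<forall>x\<in>B. dist z x \<le> e" unfolding bounded_any_center[of B z] by blast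
    have "?\<phi> x \<le> nat \<lfloor>ln (1 + e) + c\<rfloor>" if "x \<in> B" for x
    proof -
      have "g x \<le> ln (1 + e)"
        unfolding g_def
      proof (subst ln_le_cancel_iff)
        show "0 < 1 + dist z x" using zero_le_dist[of z x] by linarith
        show "0 < 1 + e" "1 + dist z x \<le> 1 + e"
          using bspec[OF e that] zero_le_dist[of z x] by linarith+
      qed
      then show ?thesis by (intro nat_mono floor_mono) simp
    qed
    then have "?\<phi> ` B \<subseteq> {..nat \<lfloor>ln (1 + e) + c\<rfloor>}" by blast
    then show "finite (?\<phi> ` B)" by (rule finite_subset) simp
  next
    fix \<epsilon>
    have "dist z x \<le> 5 * \<epsilon>"
      if x: "x \<in> ?E c" "dist x y \<le> \<epsilon>" "?\<phi> y \<noteq> ?\<phi> x" for x y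
    proof (rule ccontr)
      assume "\<not> dist z x \<le> 5 * \<epsilon>"
      then have "\<bar>g x - g y\<bar> < 1 / 4" using osc[of x y \<epsilon>] x by simp
      moreover have "1 / 4 \<le> g x + c - \<lfloor>g x + c\<rfloor>" "g x + c - \<lfloor>g x + c\<rfloor> \<le> 3 / 4"
        using x(1) by (simp_all add: frac_def)
      ultimately have "\<lfloor>g y + c\<rfloor> = \<lfloor>g x + c\<rfloor>"
        by (intro floor_unique) linarith+
      with x(3) show False by simp
    qed
    then show "bounded {x \<in> ?E c. \<exists>y. dist x y \<le> \<epsilon> \<and> ?\<phi> y \<noteq> ?\<phi> x}"
      unfolding bounded_def by (intro exI[of _ z] exI[of _ "5 * \<epsilon>"]) blast
  qed
qed

text \<open>The images \<phi>(A i) form a base modulo finite sets of the free ultrafilter \<phi>(p),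
  because preimages of its members lie in the corona filter.\<close>

lemma cardinal_u_le:
  fixes p :: "'a::metric_space filter"
  assumes p: "p \<in> topspace sharp"
    and A: "\<And>i. i \<in> I \<Longrightarrow> contains (corona_filter p) (A i)"
    and base: "\<And>S. contains (corona_filter p) S \<Longrightarrow> \<exists>i\<in>I. bounded (A i - S)"
  shows "cardinal_u \<le>o |I|"
proof -
  obtain \<phi> :: "'a \<Rightarrow> nat" and E where E: "contains p E"
    and fib: "\<And>n. bounded (\<phi> -` {n})" and fin: "\<And>B. bounded B \<Longrightarrow> finite (\<phi> ` B)"
    and E': "\<And>\<epsilon>. bounded {x \<in> E. \<exists>y. dist x y \<le> \<epsilon> \<and> \<phi> y \<noteq> \<phi> x}"
    by (rule sharp_coarse_partition[OF p]) (rule that)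
  let ?v = "filtermap \<phi> p"
  have up: "ultrafilter p" using p by (simp add: topspace_sharp)
  show ?thesis
  proof (rule remainder_min_character_le[of ?v _ "\<lambda>i. \<phi> ` A i"])
    show "ultrafilter ?v" using up by (rule ultrafilter_filtermap)
    show "?v \<le> cofinite"
    proof (rule filter_leI)
      fix P assume "eventually P (cofinite :: nat filter)"
      then have "finite {n. \<not> P n}" by (simp add: eventually_cofinite)
      then have "bounded (\<Union>n\<in>{n. \<not> P n}. \<phi> -` {n})" using fib by (intro bounded_UN) auto
      then have "contains p (- (\<Union>n\<in>{n. \<not> P n}. \<phi> -` {n}))" by (rule sharp_bounded[OF p])
      then show "eventually P ?v" unfolding eventually_filtermap by (rule eventually_mono) auto
    qed
  next
    fix i assume "i \<in> I"
    then have "contains p (A i)" using A sharp_le_corona_filter[OF p] by (auto intro: filter_leD)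
    then show "contains ?v (\<phi> ` A i)" unfolding eventually_filtermap by (rule eventually_mono) simp
  next
    fix S assume "contains ?v S"
    then have "contains p (E \<inter> \<phi> -` S)"
      using E unfolding eventually_filtermap by eventually_elim simp
    \<comment> \<open>Passing from the preimage of \<open>S\<close> to its complement changes the
      value of \<phi>, which happens near only a bounded part of \<open>E\<close>.\<close>
    moreover have "asym_disjoint (E \<inter> \<phi> -` S) (- (\<phi> -` S))"
      unfolding asym_disjoint_def
    proof
      fix \<epsilon>
      show "bounded {x \<in> E \<inter> \<phi> -` S. \<exists>y\<in>- (\<phi> -` S). dist x y \<le> \<epsilon>}"
        by (rule bounded_subset[OF E'[of \<epsilon>]]) force
    qed
    ultimately have "contains (corona_filter p) (\<phi> -` S)"
      unfolding contains_corona_filter by blast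
    then obtain i where i: "i \<in> I" "bounded (A i - \<phi> -` S)" using base by blast
    have "\<phi> ` A i - S \<subseteq> \<phi> ` (A i - \<phi> -` S)" by blast
    then have "finite (\<phi> ` A i - S)" using fin[OF i(2)] by (rule finite_subset)
    with i(1) show "\<exists>i\<in>I. finite (\<phi> ` A i - S)" by blast
  qed
qed

section \<open>Upper bounds from ultrafilters on a sequence\<close>

text \<open>Only finitely many \<open>x n\<close> lie in a bounded set, so boundedness of the
  exceptional points becomes finiteness of their indices, and natural radii suffice.\<close>

lemma sharp_sequence:
  fixes x :: "nat \<Rightarrow> 'a::metric_space"
  assumes x: "\<And>n. real n \<le> dist z (x n)" and v: "ultrafilter v" "v \<le> cofinite"
  shows "filtermap x v \<in> topspace sharp"
    and "contains (corona_filter (filtermap x v)) S \<longleftrightarrow>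
      (\<exists>A. contains v A \<and> (\<forall>k::nat. finite {n \<in> A. \<not> cball (x n) k \<subseteq> S}))" (is "_ \<longleftrightarrow> ?R")
proof -
  have fin: "finite (x -` B)" if B: "bounded B" for B
  proof -
    obtain e where "\<forall>y\<in>B. dist z y \<le> e" using B unfolding bounded_any_center[of B z] by blast
    then have "n \<le> nat \<lfloor>e\<rfloor>" if "x n \<in> B" for n
      using that x[of n] by (force simp: le_nat_floor)
    then have "x -` B \<subseteq> {..nat \<lfloor>e\<rfloor>}" by blast
    then show ?thesis by (rule finite_subset) simp
  qed
  have "contains (filtermap x v) (- B)" if "bounded B" for B
  proof -
    have "eventually (\<lambda>n. x n \<notin> B) cofinite"
      using fin[OF that] by (simp add: eventually_cofinite vimage_def)
    then show ?thesis
      unfolding eventually_filtermap using v(2) by (auto intro: filter_leD)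
  qed
  then show "filtermap x v \<in> topspace sharp"
    using ultrafilter_filtermap[OF v(1)] by (simp add: topspace_sharp)
  show "contains (corona_filter (filtermap x v)) S \<longleftrightarrow> ?R"
  proof
    assume "contains (corona_filter (filtermap x v)) S"
    then obtain P where P: "contains v (x -` P)" "asym_disjoint P (- S)"
      unfolding contains_corona_filter eventually_filtermap by auto
    have "finite {n \<in> x -` P. \<not> cball (x n) k \<subseteq> S}" for k :: nat
      using fin[OF asym_disjointD[OF P(2), of k]] by (rule finite_subset[rotated]) auto
    with P(1) show ?R by blast
  next
    assume ?R
    then obtain A where A: "contains v A" "\<And>k::nat. finite {n \<in> A. \<not> cball (x n) k \<subseteq> S}" by blast
    have "asym_disjoint (x ` A) (- S)"
      unfolding asym_disjoint_def
    proof
      fix \<epsilon> :: real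
      obtain k :: nat where "\<epsilon> \<le> k" using real_arch_simple by blast
      then have "s \<in> cball y k" if "dist y s \<le> \<epsilon>" for y s :: 'a
        using that by simp
      then have "{y \<in> x ` A. \<exists>s\<in>- S. dist y s \<le> \<epsilon>} \<subseteq> x ` {n \<in> A. \<not> cball (x n) k \<subseteq> S}"
        by blast
      then show "bounded {y \<in> x ` A. \<exists>s\<in>- S. dist y s \<le> \<epsilon>}"
        using A(2)[of k] by (meson bounded_subset finite_imageI finite_imp_bounded)
    qed
    moreover have "contains (filtermap x v) (x ` A)"
      unfolding eventually_filtermap using A(1) by (rule eventually_mono) simp
    ultimately show "contains (corona_filter (filtermap x v)) S"
      unfolding contains_corona_filter by blast
  qed
qed

lemma isolated_balls_sequence:
  assumes "\<not> bounded (UNIV :: 'a::metric_space set)" "asymptotically_isolated_balls TYPE('a)"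
  obtains \<epsilon> and x :: "nat \<Rightarrow> 'a::metric_space" where
    "\<And>n. real n \<le> dist z (x n)" "\<And>n. cball (x n) n \<subseteq> cball (x n) \<epsilon>"
proof -
  obtain \<epsilon> where \<epsilon>: "\<And>\<delta>. \<epsilon> \<le> \<delta> \<Longrightarrow> \<exists>x::'a. cball x \<epsilon> = cball x \<delta>"
    using assms(2) unfolding asymptotically_isolated_balls_def by blast
  have "\<exists>x. real n \<le> dist z x \<and> cball x n \<subseteq> cball x \<epsilon>" for n
  proof -
    obtain y where y: "n + \<epsilon> < dist z y"
      using assms(1) unfolding bounded_any_center[of UNIV z] by (auto simp: not_le)
    \<comment> \<open>If \<open>x\<close> were within \<open>n\<close> of \<open>z\<close>, the
      larger ball would contain \<open>y\<close>; then so would the \<epsilon>-ball, against the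
      choice of \<open>y\<close> farther than \<open>n + \<epsilon>\<close> from
      \<open>z\<close>.\<close>
    obtain x :: 'a where x: "cball x \<epsilon> = cball x (max \<epsilon> (n + dist z y))"
      using \<epsilon>[of "max \<epsilon> (n + dist z y)"] by auto
    have "real n \<le> dist z x"
    proof (rule ccontr)
      assume n: "\<not> real n \<le> dist z x"
      have "dist x y \<le> max \<epsilon> (n + dist z y)"
        using n dist_triangle[of x y z] by (simp add: dist_commute)
      then have "dist x y \<le> \<epsilon>" using x by (metis mem_cball)
      then show False using n y dist_triangle[of z y x] by linarith
    qed
    moreover have "cball x n \<subseteq> cball x (max \<epsilon> (n + dist z y))"
      by (rule subset_cball) (use zero_le_dist[of z y] in linarith)
    ultimately show ?thesis using x by blast
  qed
  then show thesis using that by metis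
qed

text \<open>From index \<open>k\<close> on, the ball of radius \<open>k\<close> around
  \<open>x n\<close> lies in the \<epsilon>-ball. Thus a base of \<open>v\<close> alone, fattened by
  \<epsilon>, gives a base of the corona filter.\<close>

lemma corona_le_cardinal_u:
  assumes "\<not> bounded (UNIV :: 'a::metric_space set)" "asymptotically_isolated_balls TYPE('a)"
  shows "min_character (corona :: 'a filter set topology) \<le>o cardinal_u"
proof -
  obtain \<epsilon> and x :: "nat \<Rightarrow> 'a" where x: "\<And>n. real n \<le> dist undefined (x n)"
    and iso: "\<And>n. cball (x n) n \<subseteq> cball (x n) \<epsilon>"
    by (rule isolated_balls_sequence[OF assms]) (rule that)
  show ?thesis
  proof (rule remainder_witness)
    fix v :: "nat filter" and \<B> A
    assume v: "ultrafilter v" "v \<le> cofinite" and card: "cardinal_u = |\<B>|"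
      and A: "\<And>N. N \<in> \<B> \<Longrightarrow> contains v (A N)"
      and base: "\<And>S. contains v S \<Longrightarrow> \<exists>N\<in>\<B>. finite (A N - S)"
    note seq = sharp_sequence[OF x v]
    show ?thesis
      unfolding card
    proof (rule corona_min_character_le[OF seq(1), of _ "\<lambda>N. \<Union>n\<in>A N. cball (x n) \<epsilon>"])
      fix N assume N: "N \<in> \<B>"
      have "{n \<in> A N. \<not> cball (x n) k \<subseteq> (\<Union>n\<in>A N. cball (x n) \<epsilon>)} \<subseteq> {..<k}" for k :: nat
      proof
        fix n assume n: "n \<in> {n \<in> A N. \<not> cball (x n) k \<subseteq> (\<Union>n\<in>A N. cball (x n) \<epsilon>)}"
        then have "\<not> cball (x n) k \<subseteq> cball (x n) n" using iso[of n] by blast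
        then have "\<not> k \<le> n" using subset_cball[of "real k" "real n" "x n"] by auto
        then show "n \<in> {..<k}" by simp
      qed
      then show "contains (corona_filter (filtermap x v)) (\<Union>n\<in>A N. cball (x n) \<epsilon>)"
        unfolding seq(2) using A[OF N] by (blast intro: finite_subset[OF _ finite_lessThan])
    next
      fix S assume "contains (corona_filter (filtermap x v)) S"
      then obtain C where C: "contains v C" "\<And>k::nat. finite {n \<in> C. \<not> cball (x n) k \<subseteq> S}"
        unfolding seq(2) by blast
      obtain N where N: "N \<in> \<B>" "finite (A N - C)" using base[OF C(1)] by blast
      obtain k :: nat where k: "\<epsilon> \<le> k" using real_arch_simple by blast
      let ?F = "(A N - C) \<union> {n \<in> C. \<not> cball (x n) k \<subseteq> S}"
      have "(\<Union>n\<in>A N. cball (x n) \<epsilon>) - S \<subseteq> (\<Union>n\<in>?F. cball (x n) \<epsilon>)"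
        using subset_cball[OF k] by blast
      moreover have "bounded (\<Union>n\<in>?F. cball (x n) \<epsilon>)"
        using N(2) C(2) by (intro bounded_UN) auto
      ultimately have "bounded ((\<Union>n\<in>A N. cball (x n) \<epsilon>) - S)" by (rule bounded_subset[rotated])
      with N(1) show "\<exists>N\<in>\<B>. bounded ((\<Union>n\<in>A N. cball (x n) \<epsilon>) - S)" by blast
    qed
  qed
qed

lemma cardinal_d_le: "(\<And>f :: nat \<Rightarrow> nat. \<exists>g\<in>D. f \<le> g) \<Longrightarrow> cardinal_d \<le>o |D|"
  unfolding cardinal_d_def
  by (rule cleast(2)[where R = "{|D| |D. \<forall>f. \<exists>g\<in>D. f \<le> g}"]) (auto simp: card_of_Card_order)

lemma cardinal_d_witness:
  obtains D where "cardinal_d = |D|" "\<And>f. \<exists>g\<in>D. f \<le> g"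
proof -
  have "\<forall>f. \<exists>g\<in>UNIV. f \<le> (g :: nat \<Rightarrow> nat)" by blast
  then have "cardinal_d \<in> {|D| |D. \<forall>f. \<exists>g\<in>D. f \<le> g}"
    unfolding cardinal_d_def by (intro cleast(1)) (auto simp: card_of_Card_order)
  then show thesis using that by blast
qed

text \<open>Asking for a single good argument \<open>k\<close> covers both everywhere dominating
  families and families dominating modulo finite sets.\<close>

lemma dominating_infinite:
  assumes "\<And>f :: nat \<Rightarrow> nat. \<exists>g\<in>D. \<exists>k. f k \<le> g k"
  shows "infinite D"
proof
  assume D: "finite D"
  obtain g k where "g \<in> D" "Suc (\<Sum>h\<in>D. h k) \<le> g k"
    using assms[of "\<lambda>k. Suc (\<Sum>h\<in>D. h k)"] by blast
  moreover have "g k \<le> (\<Sum>h\<in>D. h k)" using D \<open>g \<in> D\<close> by (intro member_le_sum) auto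
  ultimately show False by simp
qed

lemma corona_le_Times:
  fixes A :: "'i \<Rightarrow> nat set"
  assumes "\<not> bounded (UNIV :: 'a::metric_space set)"
    and v: "ultrafilter v" "v \<le> cofinite"
    and A: "\<And>i. i \<in> I \<Longrightarrow> contains v (A i)"
    and base: "\<And>S. contains v S \<Longrightarrow> \<exists>i\<in>I. finite (A i - S)"
    and D: "\<And>f :: nat \<Rightarrow> nat. \<exists>g\<in>D. f \<le> g"
  shows "min_character (corona :: 'a filter set topology) \<le>o |I \<times> D|"
proof -
  have "\<exists>x::'a. real n \<le> dist undefined x" for n
    using assms(1) unfolding bounded_any_center[of UNIV undefined] by (auto simp: not_le intro: less_imp_le)
  then obtain x :: "nat \<Rightarrow> 'a" where x: "\<And>n. real n \<le> dist undefined (x n)" by metis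
  note seq = sharp_sequence[OF x v]
  \<comment> \<open>The function \<open>f\<close> is a growth rate: the ball of radius
    \<open>k\<close> around \<open>x n\<close> is included once \<open>n\<close> has reached
    \<open>f k\<close>.\<close>
  let ?A = "\<lambda>(i, f). \<Union>n\<in>A i. \<Union>k\<in>{k. f k \<le> n}. cball (x n) (real k)"
  show ?thesis
  proof (rule corona_min_character_le[OF seq(1), of _ ?A])
    fix j assume "j \<in> I \<times> D"
    then obtain i f where j: "j = (i, f)" "i \<in> I" by blast
    have "{n \<in> A i. \<not> cball (x n) k \<subseteq> ?A j} \<subseteq> {..<f k}" for k :: nat
    proof
      fix n assume "n \<in> {n \<in> A i. \<not> cball (x n) k \<subseteq> ?A j}"
      then have "\<not> f k \<le> n" unfolding j(1) by auto
      then show "n \<in> {..<f k}" by simp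
    qed
    then show "contains (corona_filter (filtermap x v)) (?A j)"
      unfolding seq(2) using A[OF j(2)] by (blast intro: finite_subset[OF _ finite_lessThan])
  next
    fix S assume "contains (corona_filter (filtermap x v)) S"
    then obtain C where C: "contains v C" "\<And>k::nat. finite {n \<in> C. \<not> cball (x n) k \<subseteq> S}"
      unfolding seq(2) by blast
    obtain i where i: "i \<in> I" "finite (A i - C)" using base[OF C(1)] by blast
    \<comment> \<open>The requirement that \<open>m\<close> be at least \<open>k\<close> limits the
      radii used at index \<open>n\<close> to those at most \<open>n\<close>, which keeps the error
      coming from the finitely many indices outside \<open>C\<close> bounded.\<close>
    have "\<exists>m\<ge>k. \<forall>n\<in>C. m \<le> n \<longrightarrow> cball (x n) k \<subseteq> S" for k :: nat
    proof -
      obtain m where "\<And>n. n \<in> {n \<in> C. \<not> cball (x n) k \<subseteq> S} \<Longrightarrow> n < m"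
        using C(2)[of k] unfolding finite_nat_set_iff_bounded by blast
      then show ?thesis by (intro exI[of _ "max k m"]) force
    qed
    then obtain f\<^sub>0 where f\<^sub>0: "\<And>k. k \<le> f\<^sub>0 k"
      "\<And>k n. n \<in> C \<Longrightarrow> f\<^sub>0 k \<le> n \<Longrightarrow> cball (x n) (real k) \<subseteq> S" by metis
    obtain f where f: "f \<in> D" "f\<^sub>0 \<le> f" using D by blast
    have le: "f k \<le> n \<Longrightarrow> f\<^sub>0 k \<le> n" for k n using le_funD[OF f(2), of k] by linarith
    have "?A (i, f) - S \<subseteq> (\<Union>n\<in>A i - C. \<Union>k\<in>{..n}. cball (x n) (real k))"
    proof
      fix y assume "y \<in> ?A (i, f) - S"
      then obtain n k where nk: "n \<in> A i" "f k \<le> n" "y \<in> cball (x n) (real k)" "y \<notin> S" by auto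
      then have "n \<notin> C" using f\<^sub>0(2) le by blast
      moreover have "k \<le> n" using le[OF nk(2)] f\<^sub>0(1)[of k] by linarith
      ultimately show "y \<in> (\<Union>n\<in>A i - C. \<Union>k\<in>{..n}. cball (x n) (real k))" using nk by blast
    qed
    moreover have "bounded (\<Union>n\<in>A i - C. \<Union>k\<in>{..n}. cball (x n) (real k))"
      using i(2) by (intro bounded_UN ballI) auto
    ultimately have "bounded (?A (i, f) - S)" by (rule bounded_subset[rotated])
    with i(1) f(1) show "\<exists>j\<in>I \<times> D. bounded (?A j - S)" by blast
  qed
qed

lemma Card_order_cmax: "Card_order (cmax r s)"
  by (simp add: cmax_def card_of_Card_order)

lemma cmax_upper:
  assumes "Card_order r" "Card_order s"
  shows "r \<le>o cmax r s" "s \<le>o cmax r s"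
proof -
  have "r \<le>o cmax r s \<and> s \<le>o cmax r s"
  proof (cases "r \<le>o s")
    case True
    have "s \<le>o cmax r s"
      using cmax_eq_right[OF assms(2) True] by (rule ordIso_imp_ordLeq[OF ordIso_symmetric])
    with True show ?thesis by (blast intro: ordLeq_transitive)
  next
    case False
    have "r \<le>o cmax r s"
      using cmax_eq_left[OF assms(1) False] by (rule ordIso_imp_ordLeq[OF ordIso_symmetric])
    moreover have "s \<le>o r"
      using False assms by (meson card_order_on_def ordLeq_total)
    ultimately show ?thesis by (blast intro: ordLeq_transitive)
  qed
  then show "r \<le>o cmax r s" "s \<le>o cmax r s" by blast+
qed

lemma cmax_least:
  assumes "Card_order r" "Card_order s" "r \<le>o t" "s \<le>o t"
  shows "cmax r s \<le>o t"
proof (cases "r \<le>o s")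
  case True
  show ?thesis using cmax_eq_right[OF assms(2) True] assms(4) by (rule ordIso_ordLeq_trans)
next
  case False
  show ?thesis using cmax_eq_left[OF assms(1) False] assms(3) by (rule ordIso_ordLeq_trans)
qed

lemma corona_le_cmax:
  assumes "\<not> bounded (UNIV :: 'a::metric_space set)"
  shows "min_character (corona :: 'a filter set topology) \<le>o cmax cardinal_u cardinal_d"
proof (rule remainder_witness)
  fix v :: "nat filter" and \<B> A
  assume v: "ultrafilter v" "v \<le> cofinite" and u: "cardinal_u = |\<B>|"
    and A: "\<And>N. N \<in> \<B> \<Longrightarrow> contains v (A N)"
    and base: "\<And>S. contains v S \<Longrightarrow> \<exists>N\<in>\<B>. finite (A N - S)"
  obtain D where d: "cardinal_d = |D|" and D: "\<And>f. \<exists>g\<in>D. f \<le> g"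
    using cardinal_d_witness by blast
  let ?m = "cmax cardinal_u cardinal_d"
  have le: "|\<B>| \<le>o ?m" "|D| \<le>o ?m"
    using cmax_upper[of "cardinal_u" "cardinal_d"] unfolding u d by (simp_all add: card_of_Card_order)
  \<comment> \<open>An infinite dominating family makes the maximum infinite, so it absorbs the
    product.\<close>
  have "infinite D"
  proof (rule dominating_infinite)
    fix f :: "nat \<Rightarrow> nat"
    obtain g where "g \<in> D" "f \<le> g" using D by blast
    then show "\<exists>g\<in>D. \<exists>k. f k \<le> g k" by (auto dest: le_funD)
  qed
  moreover have "|D| \<le>o |Field ?m|"
    using le(2) ordIso_symmetric[OF card_of_Field_ordIso[OF Card_order_cmax]] by (rule ordLeq_ordIso_trans)
  ultimately have "infinite (Field ?m)" using card_of_ordLeq_infinite by blast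
  then have "|\<B> \<times> D| \<le>o ?m"
    using le Card_order_cmax by (rule card_of_Times_ordLeq_infinite_Field)
  moreover have "min_character (corona :: 'a filter set topology) \<le>o |\<B> \<times> D|"
    using assms v A base D by (rule corona_le_Times)
  ultimately show ?thesis by (rule ordLeq_transitive[rotated])
qed

section \<open>Spaces without asymptotically isolated balls\<close>

text \<open>Zorn's lemma; it will supply a maximal separated set, that is, a net with variable
  mesh.\<close>

lemma maximal_pairwise:
  assumes "\<And>x y. R x y \<Longrightarrow> R y x"
  obtains M where "pairwise R M" "\<And>z. z \<notin> M \<Longrightarrow> \<exists>x\<in>M. \<not> R x z"
proof -
  have "\<exists>M\<in>Collect (pairwise R). \<forall>X\<in>Collect (pairwise R). M \<subseteq> X \<longrightarrow> X = M"
  proof (rule subset_Zorn')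
    fix C assume "subset.chain (Collect (pairwise R)) C"
    then show "\<Union>C \<in> Collect (pairwise R)"
      using pairwise_chain_Union[of C R] by (auto simp: subset_chain_def chain_subset_def)
  qed
  then obtain M where M: "pairwise R M" "\<And>X. pairwise R X \<Longrightarrow> M \<subseteq> X \<Longrightarrow> X = M" by auto
  have "\<exists>x\<in>M. \<not> R x z" if "z \<notin> M" for z
  proof (rule ccontr)
    assume "\<not> (\<exists>x\<in>M. \<not> R x z)"
    then have "pairwise R (insert z M)"
      using M(1) assms by (auto simp: pairwise_insert)
    then show False using M(2)[of "insert z M"] that by blast
  qed
  with M(1) show thesis by (rule that)
qed

lemma not_isolated_balls_scales:
  assumes "\<not> asymptotically_isolated_balls TYPE('a::metric_space)"
  obtains r :: "nat \<Rightarrow> real" where "\<And>k. real k \<le> r k" "mono r"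
    "\<And>k (x::'a). \<exists>y. r k < dist x y \<and> dist x y \<le> r (Suc k)"
proof -
  have "\<exists>\<delta>. \<forall>x::'a. \<exists>y. \<epsilon> < dist x y \<and> dist x y \<le> \<delta>" for \<epsilon> :: real
  proof -
    obtain \<delta> where \<delta>: "\<epsilon> \<le> \<delta>" "\<And>x::'a. cball x \<epsilon> \<noteq> cball x \<delta>"
      using assms unfolding asymptotically_isolated_balls_def by blast
    have "\<exists>y. \<epsilon> < dist x y \<and> dist x y \<le> \<delta>" for x :: 'a
    proof -
      have "cball x \<epsilon> \<subset> cball x \<delta>" using \<delta> subset_cball by blast
      then show ?thesis by (auto simp: not_le)
    qed
    then show ?thesis by blast
  qed
  then obtain \<Delta> where \<Delta>: "\<And>\<epsilon> (x::'a). \<exists>y. \<epsilon> < dist x y \<and> dist x y \<le> \<Delta> \<epsilon>" by metis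
  \<comment> \<open>Each scale is followed by one whose balls are strictly larger everywhere; the
    maximum with \<open>t + 1\<close> makes the scales tend to infinity.\<close>
  define r where "r = rec_nat (0::real) (\<lambda>k t. max (\<Delta> t) (t + 1))"
  have r: "r 0 = 0" "r (Suc k) = max (\<Delta> (r k)) (r k + 1)" for k by (simp_all add: r_def)
  show thesis
  proof
    fix k
    show "real k \<le> r k" by (induction k) (auto simp: r)
    show "\<exists>y. r k < dist x y \<and> dist x y \<le> r (Suc k)" for x :: 'a
      using \<Delta>[of "r k" x] by (auto simp: r)
  next
    show "mono r" unfolding mono_iff_le_Suc by (simp add: r le_max_iff_disj)
  qed
qed

text \<open>\<open>S\<close> is a net whose mesh \<open>\<sigma>\<close> grows with the distance to \<open>z\<close>, so slowly that the scale
  is still at most \<open>r (Suc k)\<close> within distance \<open>f k\<close>; \<open>T\<close> is the complement of the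
  \<open>\<tau>\<close>-neighborhood of \<open>S\<close>, where \<open>\<tau> \<le> \<sigma>\<close> is the preceding scale.\<close>

lemma interlaced_sets:
  fixes z :: "'a::metric_space" and f :: "nat \<Rightarrow> nat"
  assumes r: "\<And>k. real k \<le> r k" "mono r"
    and gap: "\<And>k (x::'a). \<exists>y. r k < dist x y \<and> dist x y \<le> r (Suc k)"
  obtains S T :: "'a set" where "asym_disjoint S T"
    "\<And>k x. dist z x < f k \<Longrightarrow> cball x (3 * r (Suc k)) \<inter> S \<noteq> {} \<and> cball x (3 * r (Suc k)) \<inter> T \<noteq> {}"
proof -
  define c where "c = 4 * r 1"
  \<comment> \<open>The term with \<open>f k\<close> keeps the scale low up to distance
    \<open>f k\<close>, with room for a neighboring net point. The term
    \<open>4 * r (Suc (Suc k))\<close> keeps \<sigma> below a quarter of the distance once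
    \<open>j\<close> is positive; \<open>c\<close> covers the case \<open>j = 0\<close>.\<close>
  define F where "F k = max (2 * f k + c) (4 * r (Suc (Suc k)))" for k
  define j where "j t = (LEAST i. t < F i)" for t
  define \<sigma> where "\<sigma> x = r (Suc (j (dist z x)))" for x
  define \<tau> where "\<tau> x = r (j (dist z x))" for x
  have c0: "0 \<le> c" using r(1)[of 1] by (simp add: c_def)
  have F0: "0 \<le> F i" for i using c0 by (simp add: F_def le_max_iff_disj)
  have "\<exists>i. t < F i" for t
  proof -
    obtain i :: nat where "t < i" using reals_Archimedean2 by blast
    also have "real i \<le> 4 * r (Suc (Suc i))" using r(1)[of "Suc (Suc i)"] by simp
    also have "\<dots> \<le> F i" by (simp add: F_def)
    finally show ?thesis ..
  qed
  then have j_less: "t < F (j t)" for t unfolding j_def by (rule LeastI_ex)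
  have j_le: "t < F k \<Longrightarrow> j t \<le> k" for t k unfolding j_def by (rule Least_le)
  have r_pos: "0 < r (Suc k)" for k using r(1)[of "Suc k"] by simp
  have \<sigma>0: "0 < \<sigma> x" for x by (simp add: \<sigma>_def r_pos)
  have \<tau>\<sigma>: "\<tau> x \<le> \<sigma> x" for x unfolding \<tau>_def \<sigma>_def using r(2) by (simp add: mono_def)
  have \<sigma>_small: "4 * \<sigma> x \<le> dist z x + c" for x
  proof (cases "j (dist z x)")
    case 0
    then show ?thesis by (simp add: \<sigma>_def c_def)
  next
    case (Suc i)
    then have "\<not> dist z x < F i" using j_le[of "dist z x" i] by auto
    then show ?thesis using c0 by (simp add: \<sigma>_def Suc F_def)
  qed
  let ?R = "\<lambda>x y. 2 * max (\<sigma> x) (\<sigma> y) \<le> dist x y"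
  obtain S where S: "pairwise ?R S" "\<And>w. w \<notin> S \<Longrightarrow> \<exists>x\<in>S. \<not> ?R x w"
    by (rule maximal_pairwise[of ?R]) (auto simp: dist_commute max.commute)
  let ?T = "{y. \<forall>x\<in>S. \<tau> x \<le> dist x y}"
  show thesis
  proof (rule that)
    show "asym_disjoint S ?T"
      unfolding asym_disjoint_def
    proof
      fix \<epsilon> :: real
      \<comment> \<open>A point of \<open>S\<close> within \<epsilon> of \<open>?T\<close> has
        \<tau> at most \<epsilon>, so its index \<open>j\<close> is bounded. As \<open>F\<close>
        need not be monotone, a sum bounds its values.\<close>
      have "dist z s \<le> (\<Sum>i\<le>nat \<lfloor>\<epsilon>\<rfloor>. F i)" if "s \<in> S" "t \<in> ?T" "dist s t \<le> \<epsilon>" for s t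
      proof -
        have "\<tau> s \<le> \<epsilon>" using that by force
        then have "j (dist z s) \<le> nat \<lfloor>\<epsilon>\<rfloor>"
          using r(1)[of "j (dist z s)"] by (intro le_nat_floor) (simp add: \<tau>_def)
        then have "F (j (dist z s)) \<le> (\<Sum>i\<le>nat \<lfloor>\<epsilon>\<rfloor>. F i)"
          using F0 by (intro member_le_sum) auto
        then show ?thesis using j_less[of "dist z s"] by linarith
      qed
      then show "bounded {x \<in> S. \<exists>y\<in>?T. dist x y \<le> \<epsilon>}"
        unfolding bounded_def by blast
    qed
  next
    fix k w assume w: "dist z w < f k"
    have fF: "2 * f k + c \<le> F k" by (simp add: F_def)
    have "j (dist z w) \<le> k" using w fF c0 by (intro j_le) linarith
    then have \<sigma>w: "\<sigma> w \<le> r (Suc k)" unfolding \<sigma>_def using r(2) by (simp add: mono_def)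
    obtain x where x: "x \<in> S" "dist x w < 2 * max (\<sigma> x) (\<sigma> w)"
    proof (cases "w \<in> S")
      case True
      then show ?thesis using that[of w] \<sigma>0[of w] by simp
    next
      case False
      then show ?thesis using S(2)[OF False] that by (auto simp: not_le)
    qed
    \<comment> \<open>If \<sigma> is larger at \<open>x\<close>, then \<open>dist x w\<close> is
      below \<open>2 * \<sigma> x\<close>, at most half of \<open>dist z x + c\<close>. Hence
      \<open>dist z x\<close> is at most \<open>2 * dist z w + c\<close>, which is below
      \<open>F k\<close>.\<close>
    have \<sigma>x: "\<sigma> x \<le> r (Suc k)"
    proof (cases "\<sigma> x \<le> \<sigma> w")
      case True
      then show ?thesis using \<sigma>w by linarith
    next
      case False
      then have "dist z x \<le> 2 * dist z w + c"
        using x(2) \<sigma>_small[of x] dist_triangle[of z x w] by (simp add: dist_commute max_def)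
      then have "dist z x < F k" using w fF by linarith
      then have "j (dist z x) \<le> k" by (rule j_le)
      then show ?thesis unfolding \<sigma>_def using r(2) by (simp add: mono_def)
    qed
    \<comment> \<open>The gap puts \<open>y\<close> between the scales \<tau> and \<sigma> at
      \<open>x\<close>. Any other net point \<open>x'\<close> is at least
      \<open>\<sigma> x' + \<sigma> x\<close> away from \<open>x\<close>, hence at least
      \<open>\<sigma> x'\<close> away from \<open>y\<close>.\<close>
    obtain y where y: "\<tau> x < dist x y" "dist x y \<le> \<sigma> x"
      using gap[of "j (dist z x)" x] unfolding \<tau>_def \<sigma>_def by blast
    have "\<tau> x' \<le> dist x' y" if "x' \<in> S" for x'
    proof (cases "x' = x")
      case False
      then have "2 * max (\<sigma> x') (\<sigma> x) \<le> dist x' x" using S(1) that x(1) by (auto simp: pairwise_def)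
      then have "\<sigma> x' + \<sigma> x \<le> dist x' x" by linarith
      then show ?thesis using \<tau>\<sigma>[of x'] y(2) dist_triangle[of x' x y] by (simp add: dist_commute)
    qed (use y in simp)
    then have "y \<in> ?T" by blast
    have wx: "dist w x \<le> 2 * r (Suc k)" using x(2) \<sigma>x \<sigma>w by (simp add: dist_commute)
    then have "x \<in> cball w (3 * r (Suc k))" using r_pos[of k] by simp
    moreover have "y \<in> cball w (3 * r (Suc k))"
      using wx y(2) \<sigma>x dist_triangle[of w y x] by simp
    ultimately show "cball w (3 * r (Suc k)) \<inter> S \<noteq> {} \<and> cball w (3 * r (Suc k)) \<inter> ?T \<noteq> {}"
      using x(1) \<open>y \<in> ?T\<close> by blast
  qed
qed

section \<open>The lower bound by the dominating number\<close>

lemma sharp_asym_disjoint: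
  assumes "p \<in> topspace sharp" "asym_disjoint S T"
  shows "contains (corona_filter p) (- S) \<or> contains (corona_filter p) (- T)"
proof -
  obtain M where M: "asym_disjoint M S" "asym_disjoint (- M) T"
    using asym_disjoint_separate[OF assms(2)] .
  have "contains p M \<or> contains p (- M)"
    using assms(1) ultrafilter_Compl[of p M] unfolding topspace_sharp by blast
  then show ?thesis
    unfolding contains_corona_filter using M by auto
qed

text \<open>Take a member \<open>P\<close> of \<open>p\<close> asymptotically disjoint from the
  complement of \<open>A\<close>. Removing the bounded set of points too close to that complement or
  to \<open>z\<close> leaves a nonempty set.\<close>

lemma corona_filter_deep_points:
  assumes p: "p \<in> topspace sharp" and A: "contains (corona_filter p) A"
  obtains x where "b \<le> dist z x" "cball x \<rho> \<subseteq> A"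
proof -
  obtain P where P: "contains p P" "asym_disjoint P (- A)"
    using A unfolding contains_corona_filter by blast
  let ?B = "{x \<in> P. \<exists>y\<in>- A. dist x y \<le> \<rho>} \<union> cball z b"
  have "contains p (- ?B)"
    using p asym_disjointD[OF P(2)] by (intro sharp_bounded) simp_all
  then have "contains p (P \<inter> - ?B)" using P(1) unfolding contains_Int by blast
  then have "P \<inter> - ?B \<noteq> {}" using p by (intro ultrafilter_nonempty) (simp_all add: topspace_sharp)
  then obtain x where "x \<in> P" "x \<notin> ?B" by blast
  then show thesis using that[of x] by force
qed

lemma cardinal_d_le_corona:
  fixes p :: "'a::metric_space filter"
  assumes p: "p \<in> topspace sharp"
    and A: "\<And>i. i \<in> I \<Longrightarrow> contains (corona_filter p) (A i)"
    and base: "\<And>S. contains (corona_filter p) S \<Longrightarrow> \<exists>i\<in>I. bounded (A i - S)"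
    and "\<not> asymptotically_isolated_balls TYPE('a)"
  shows "cardinal_d \<le>o |I|"
proof -
  obtain r where r: "\<And>k. real k \<le> r k" "mono r"
    and gap: "\<And>k (x::'a). \<exists>y. r k < dist x y \<and> dist x y \<le> r (Suc k)"
    using not_isolated_balls_scales[OF assms(4)] by blast
  define z :: 'a where "z = undefined"
  define \<rho> where "\<rho> k = 3 * r (Suc k)" for k
  \<comment> \<open>The lower bound on \<open>dist z x\<close> keeps the whole ball at distance at
    least \<open>k\<close> from \<open>z\<close>, so for large \<open>k\<close> it avoids any given
    bounded error set.\<close>
  define Q where "Q i k n \<longleftrightarrow> (\<exists>x. \<rho> k + real k \<le> dist z x \<and> dist z x < real n \<and> cball x (\<rho> k) \<subseteq> A i)"
    for i k n
  define h where "h i k = (LEAST n. Q i k n)" for i k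
  have Qh: "Q i k (h i k)" if i: "i \<in> I" for i k
  proof -
    obtain x where x: "\<rho> k + real k \<le> dist z x" "cball x (\<rho> k) \<subseteq> A i"
      using corona_filter_deep_points[OF p A[OF i]] by blast
    obtain n :: nat where "dist z x < n" using reals_Archimedean2 by blast
    with x have "Q i k n" unfolding Q_def by blast
    then show ?thesis unfolding h_def by (rule LeastI)
  qed
  \<comment> \<open>Up to a bounded set, some \<open>A i\<close> misses \<open>U\<close>, while
    \<open>U\<close> meets every ball of scale \<open>k\<close> centered closer than
    \<open>f k\<close>. So for large \<open>k\<close> the first deep ball of scale \<open>k\<close>
    in \<open>A i\<close> cannot occur before \<open>f k\<close>.\<close>
  have dom: "\<exists>i\<in>I. \<exists>m. \<forall>k\<ge>m. f k \<le> h i k" for f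
  proof -
    obtain S T :: "'a set" where ST: "asym_disjoint S T"
      "\<And>k x. dist z x < f k \<Longrightarrow> cball x (\<rho> k) \<inter> S \<noteq> {} \<and> cball x (\<rho> k) \<inter> T \<noteq> {}"
      using interlaced_sets[OF r gap, where z = z and f = f] unfolding \<rho>_def by blast
    obtain U where U: "contains (corona_filter p) (- U)"
      "\<And>k x. dist z x < f k \<Longrightarrow> cball x (\<rho> k) \<inter> U \<noteq> {}"
      using sharp_asym_disjoint[OF p ST(1)] ST(2) by blast
    obtain i where i: "i \<in> I" "bounded (A i - (- U))" using base[OF U(1)] by blast
    obtain e where e: "\<And>y. y \<in> A i \<Longrightarrow> y \<in> U \<Longrightarrow> dist z y \<le> e"
      using i(2) unfolding bounded_any_center[of _ z] by auto
    obtain m :: nat where m: "e < m" using reals_Archimedean2 by blast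
    have "f k \<le> h i k" if "m \<le> k" for k
    proof (rule ccontr)
      assume "\<not> f k \<le> h i k"
      moreover obtain x where x: "\<rho> k + real k \<le> dist z x" "dist z x < h i k" "cball x (\<rho> k) \<subseteq> A i"
        using Qh[OF i(1), of k] unfolding Q_def by blast
      ultimately have "dist z x < f k" by linarith
      then obtain y where "y \<in> cball x (\<rho> k)" "y \<in> U" using U(2) by blast
      then have "dist x y \<le> \<rho> k" "dist z y \<le> e" using x(3) e by auto
      then show False
        using x(1) m that dist_triangle[of z x y] by (simp add: dist_commute)
    qed
    with i(1) show ?thesis by blast
  qed
  have "infinite (h ` I)"
  proof (rule dominating_infinite)
    fix f :: "nat \<Rightarrow> nat"
    show "\<exists>g\<in>h ` I. \<exists>k. f k \<le> g k" using dom[of f] by blast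
  qed
  then have inf: "infinite I" by blast
  \<comment> \<open>Adding constants turns domination from \<open>m\<close> on into domination
    everywhere; as \<open>I\<close> is infinite, this does not raise the cardinality.\<close>
  let ?D = "(\<lambda>(i, m) k. h i k + m) ` (I \<times> (UNIV :: nat set))"
  have "cardinal_d \<le>o |?D|"
  proof (rule cardinal_d_le)
    fix f :: "nat \<Rightarrow> nat"
    obtain i m where im: "i \<in> I" "\<And>k. m \<le> k \<Longrightarrow> f k \<le> h i k" using dom[of f] by blast
    have "f k \<le> h i k + (\<Sum>l<m. f l)" for k
    proof (cases "m \<le> k")
      case False
      then have "f k \<le> (\<Sum>l<m. f l)" by (intro member_le_sum) auto
      then show ?thesis by simp
    qed (use im(2) trans_le_add1 in blast)
    then have "f \<le> (\<lambda>(i, m) k. h i k + m) (i, \<Sum>l<m. f l)" by (simp add: le_fun_def)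
    with im(1) show "\<exists>g\<in>?D. f \<le> g" by blast
  qed
  also have "|?D| \<le>o |I \<times> (UNIV :: nat set)|" by (rule card_of_image)
  also have "|I \<times> (UNIV :: nat set)| =o |I|"
    using inf infinite_iff_card_of_nat[of I] by (intro card_of_Times_infinite_simps(1)) auto
  finally show ?thesis .
qed

theorem theorem1p2:
  assumes "\<not> bounded (UNIV :: 'a::metric_space set)"
  shows "(asymptotically_isolated_balls TYPE('a) \<longrightarrow>
            min_character (corona :: 'a filter set topology) =o cardinal_u) \<and>
         (\<not> asymptotically_isolated_balls TYPE('a) \<longrightarrow>
            min_character (corona :: 'a filter set topology) =o cmax cardinal_u cardinal_d)"
proof (rule corona_witness[OF assms])
  fix p :: "'a filter" and \<B> :: "'a filter set set set" and A
  assume p: "p \<in> topspace sharp"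
    and card: "min_character (corona :: 'a filter set topology) = |\<B>|"
    and A: "\<And>N. N \<in> \<B> \<Longrightarrow> contains (corona_filter p) (A N)"
    and base: "\<And>S. contains (corona_filter p) S \<Longrightarrow> \<exists>N\<in>\<B>. bounded (A N - S)"
  let ?m = "min_character (corona :: 'a filter set topology)"
  have u: "cardinal_u \<le>o ?m" unfolding card by (rule cardinal_u_le[OF p A base])
  have "Card_order cardinal_u"
    by (rule remainder_witness) (metis card_of_Card_order)
  moreover have "Card_order cardinal_d"
    by (rule cardinal_d_witness) (metis card_of_Card_order)
  moreover have "cardinal_d \<le>o ?m" if "\<not> asymptotically_isolated_balls TYPE('a)"
    unfolding card by (rule cardinal_d_le_corona[OF p A base that])
  ultimately have "cmax cardinal_u cardinal_d \<le>o ?m" if "\<not> asymptotically_isolated_balls TYPE('a)"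
    using u that by (blast intro: cmax_least)
  then show ?thesis
    using u corona_le_cardinal_u[OF assms] corona_le_cmax[OF assms] by (auto simp: ordIso_iff_ordLeq)
qed

end
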